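(* Let $d\ge 1$ and let $\mathcal{F}$ be a face uniform subdivision (in dimension $d-1$) such that its $h$-vector transformation matrix $H_{\mathcal{F}}$ is TP$_2$. Then for every $(d-1)$-dimensional simplicial complex $\Delta$, with $\Delta_{\mathcal{F}}$ denoting the complex subdivided according to $\mathcal{F}$, the following hold. (i) If $h_0^\Delta,\ldots,h_d^\Delta>0$ and $$\frac{h_0^\Delta}{h_d^\Delta}\le \frac{h_1^\Delta}{h_{d-1}^\Delta}\le\cdots\le\frac{h_{d-1}^\Delta}{h_1^\Delta}\le\frac{h_d^\Delta}{h_0^\Delta},$$ then $h_0^{\Delta_{\mathcal{F}}},\ldots,h_d^{\Delta_{\mathcal{F}}}>0$ and $$\frac{h_0^{\Delta_{\mathcal{F}}}}{h_d^{\Delta_{\mathcal{F}}}}\le \frac{h_1^{\Delta_{\mathcal{F}}}}{h_{d-1}^{\Delta_{\mathcal{F}}}}\le\cdots\le\frac{h_{d-1}^{\Delta_{\mathcal{F}}}}{h_1^{\Delta_{\mathcal{F}}}}\le\frac{h_d^{\Delta_{\mathcal{F}}}}{h_0^{\Delta_{\mathcal{F}}}}.$$ (ii) If $h_1^\Delta,\ldots,h_{d-1}^\Delta>0$, $h_d^\Delta=0$ and $$\frac{h_1^\Delta}{h_{d-1}^\Delta}\ge\cdots\ge\frac{h_{d-2}^\Delta}{h_2^\Delta}\ge\frac{h_{d-1}^\Delta}{h_1^\Delta},$$ then $h_1^{\Delta_{\mathcal{F}}},\ldots,h_{d-1}^{\Delta_{\mathcal{F}}}>0$, $h_d^{\Delta_{\mathcal{F}}}=0$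 and $$\frac{h_1^{\Delta_{\mathcal{F}}}}{h_{d-1}^{\Delta_{\mathcal{F}}}}\ge\cdots\ge\frac{h_{d-2}^{\Delta_{\mathcal{F}}}}{h_2^{\Delta_{\mathcal{F}}}}\ge\frac{h_{d-1}^{\Delta_{\mathcal{F}}}}{h_1^{\Delta_{\mathcal{F}}}}.$$
   Context: Simplicial complexes are finite and abstract; the dimension of a face $\sigma$ is $\#\sigma-1$. For a $(d-1)$-dimensional simplicial complex $\Delta$, let $f_i^\Delta$ be the number of $i$-dimensional faces ($-1\le i\le d-1$), $f^\Delta(x)=\sum_{i=0}^d f_{i-1}^\Delta x^{d-i}$, and define the $h$-vector $h^\Delta=(h_0^\Delta,\ldots,h_d^\Delta)$ by $f^\Delta(x-1)=\sum_{i=0}^d h_i^\Delta x^{d-i}$. A simplicial complex $\Delta'$ is a face uniform triangulation (or subdivision) of $\Delta$ if there are geometric realizations with $|\Delta|=|\Delta'|$ such that (1) each $|\sigma|$, $\sigma\in\Delta$, is a union of sets $|\sigma'|$ with $\sigma'\in\Delta'$, and (2) there are numbers $f_{ij}$, $0\le i\le j\le\dim\Delta$, such that for every $j$-dimensional face $\sigma\in\Delta$ one has $f_{ij}=\#\{\tau\in\Delta' : |\tau|\subseteq|\sigma|,\ \dim\tau=i\}$. One writes $\mathcal{F}$ for the triangular array $(f_{ij})$, calls $\mathcal{F}$ a face uniform triangulation (subdivision) in dimension $d-1$, and writes $\Delta_{\mathcal{F}}$ for $\Delta'$. It is known (Athanasiadis) that there is a $(d+1)\times(d+1)$ matrix $H_{\mathcal{F}}=(h_{ij})_{0\le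 i,j\le d}$, depending only on $\mathcal{F}$ and $d$, such that $h^{\Delta_{\mathcal{F}}}=H_{\mathcal{F}}\,h^\Delta$ (column vectors) for every $(d-1)$-dimensional simplicial complex $\Delta$, and that $h_{ij}=h_{d-i,d-j}$. Explicitly, with $g_{ij}=\sum_{k=i}^{j}(-1)^{j-k}\binom{j+1}{k+1}f_{ik}$ for $0\le i\le j\le d-1$, one has $f_i^{\Delta_{\mathcal{F}}}=\sum_{j=i}^{d-1} g_{ij}f_j^\Delta$ for $0\le i\le d-1$ and $f_{-1}^{\Delta_{\mathcal{F}}}=f_{-1}^\Delta$; $H_{\mathcal{F}}$ is the matrix of this linear map after passing from $f$-vectors to $h$-vectors on both sides. A real matrix is TP$_2$ if all its entries and all its $2\times2$ minors are non-negative. *)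

theory Defs
  imports
    "HOL-Analysis.Analysis"
    "HOL-Computational_Algebra.Polynomial"
    "Jordan_Normal_Form.Matrix"
begin

section \<open>Simplicial complexes, face numbers and h-vectors\<close>

text \<open>Complexes contain the empty face, of dimension \<open>-1\<close>.\<close>

definition abstract_simplicial_complex :: "'a set set \<Rightarrow> bool" where
  "abstract_simplicial_complex \<Delta> \<longleftrightarrow>
     finite \<Delta> \<and> (\<forall>\<sigma>\<in>\<Delta>. finite \<sigma>) \<and> {} \<in> \<Delta> \<and> (\<forall>\<sigma>\<in>\<Delta>. \<forall>\<tau>. \<tau> \<subseteq> \<sigma> \<longrightarrow> \<tau> \<in> \<Delta>)"

definition face_dim :: "'a set \<Rightarrow> int" where
  "face_dim \<sigma> = int (card \<sigma>) - 1"

definition complex_dim :: "'a set set \<Rightarrow> int" where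
  "complex_dim \<Delta> = Max (face_dim ` \<Delta>)"

definition face_number :: "'a set set \<Rightarrow> int \<Rightarrow> nat" where
  "face_number \<Delta> i = card {\<sigma> \<in> \<Delta>. face_dim \<sigma> = i}"

text \<open>
  A vector with \<open>d + 1\<close> entries is a function on the naturals of which only the values at
  \<open>0, \<dots>, d\<close> matter. Entry \<open>i\<close> of an f-vector is the number of faces of dimension \<open>i - 1\<close>
  (that is, with \<open>i\<close> vertices).
\<close>

definition f_vector :: "'a set set \<Rightarrow> nat \<Rightarrow> real" where
  "f_vector \<Delta> i = real (face_number \<Delta> (int i - 1))"

definition vec_poly :: "nat \<Rightarrow> (nat \<Rightarrow> real) \<Rightarrow> real poly" where
  "vec_poly d v = (\<Sum>i\<le>d. monom (v i) (d - i))"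

text \<open>
  The vectors \<open>f\<close> and \<open>h\<close> correspond when \<open>f(x - 1) = h(x)\<close>, equivalently \<open>f(x) = h(x + 1)\<close>, for
  their polynomials \<^const>\<open>vec_poly\<close>; entry \<open>i\<close> is the coefficient of \<open>x\<close> to the power \<open>d - i\<close>.
\<close>

definition f_to_h :: "nat \<Rightarrow> (nat \<Rightarrow> real) \<Rightarrow> nat \<Rightarrow> real" where
  "f_to_h d f i = coeff (pcompose (vec_poly d f) [:-1, 1:]) (d - i)"

definition h_to_f :: "nat \<Rightarrow> (nat \<Rightarrow> real) \<Rightarrow> nat \<Rightarrow> real" where
  "h_to_f d h i = coeff (pcompose (vec_poly d h) [:1, 1:]) (d - i)"

definition h_vector :: "'a set set \<Rightarrow> nat \<Rightarrow> real" where
  "h_vector \<Delta> = f_to_h (nat (complex_dim \<Delta> + 1)) (f_vector \<Delta>)"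

section \<open>Face uniform triangulations\<close>

definition face_body :: "('a \<Rightarrow> 'e::euclidean_space) \<Rightarrow> 'a set \<Rightarrow> 'e set" where
  "face_body \<phi> \<sigma> = convex hull (\<phi> ` \<sigma>)"

text \<open>
  A realization is given by the positions of the vertices. Since \<^const>\<open>simplicial_complex\<close> is a
  property of a set of convex bodies, the first two conditions are needed to make a face with \<open>k\<close>
  vertices a genuine simplex with these \<open>k\<close> vertices.
\<close>

definition geometric_realization :: "'a set set \<Rightarrow> ('a \<Rightarrow> 'e::euclidean_space) \<Rightarrow> bool" where
  "geometric_realization \<Delta> \<phi> \<longleftrightarrow>
     inj_on \<phi> (\<Union>\<Delta>) \<and>
     (\<forall>\<sigma>\<in>\<Delta>. \<not> affine_dependent (\<phi> ` \<sigma>)) \<and>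
     simplicial_complex (face_body \<phi> ` \<Delta>)"

text \<open>
  The first argument only names the ambient Euclidean space, because a type cannot be quantified
  existentially. The entry \<open>F i j\<close> is relevant only for \<open>i \<le> j\<close> and \<open>j\<close> at most the dimension of
  \<open>\<Delta>\<close>.
\<close>

definition face_uniform_triangulation ::
    "'e::euclidean_space itself \<Rightarrow> (nat \<Rightarrow> nat \<Rightarrow> nat) \<Rightarrow> 'a set set \<Rightarrow> 'b set set \<Rightarrow> bool" where
  "face_uniform_triangulation (_ :: 'e itself) F \<Delta> \<Delta>' \<longleftrightarrow>
     abstract_simplicial_complex \<Delta> \<and> abstract_simplicial_complex \<Delta>' \<and>
     (\<exists>(\<phi> :: 'a \<Rightarrow> 'e) (\<psi> :: 'b \<Rightarrow> 'e).
        geometric_realization \<Delta> \<phi> \<and> geometric_realization \<Delta>' \<psi> \<and>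
        (\<Union>\<sigma>\<in>\<Delta>. face_body \<phi> \<sigma>) = (\<Union>\<tau>\<in>\<Delta>'. face_body \<psi> \<tau>) \<and>
        (\<forall>\<sigma>\<in>\<Delta>. \<exists>S\<subseteq>\<Delta>'. face_body \<phi> \<sigma> = (\<Union>\<tau>\<in>S. face_body \<psi> \<tau>)) \<and>
        (\<forall>\<sigma>\<in>\<Delta>. \<forall>i j. face_dim \<sigma> = int j \<and> i \<le> j \<longrightarrow>
           F i j = card {\<tau> \<in> \<Delta>'. face_body \<psi> \<tau> \<subseteq> face_body \<phi> \<sigma> \<and> face_dim \<tau> = int i}))"

section \<open>The h-vector transformation matrix\<close>

definition g_coeff :: "(nat \<Rightarrow> nat \<Rightarrow> nat) \<Rightarrow> nat \<Rightarrow> nat \<Rightarrow> real" where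
  "g_coeff F i j = (\<Sum>k=i..j. (-1) ^ (j - k) * real ((j + 1) choose (k + 1)) * real (F i k))"

text \<open>
  The map taking the f-vector of a complex of dimension \<open>d - 1\<close> to that of its triangulation.
  Entry \<open>Suc i\<close> is the number of faces of dimension \<open>i\<close>.
\<close>

definition f_transform :: "nat \<Rightarrow> (nat \<Rightarrow> nat \<Rightarrow> nat) \<Rightarrow> (nat \<Rightarrow> real) \<Rightarrow> nat \<Rightarrow> real" where
  "f_transform d F f n =
     (case n of 0 \<Rightarrow> f 0 | Suc i \<Rightarrow> (\<Sum>j=i..<d. g_coeff F i j * f (Suc j)))"

text \<open>Column \<open>j\<close> is the image of the \<open>j\<close>-th standard basis vector, read as an h-vector.\<close>

definition H_matrix :: "nat \<Rightarrow> (nat \<Rightarrow> nat \<Rightarrow> nat) \<Rightarrow> real mat" where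
  "H_matrix d F = mat (d + 1) (d + 1)
     (\<lambda>(i, j). f_to_h d (f_transform d F (h_to_f d (\<lambda>k. if k = j then 1 else 0))) i)"

definition TP2 :: "real mat \<Rightarrow> bool" where
  "TP2 A \<longleftrightarrow>
     (\<forall>i<dim_row A. \<forall>j<dim_col A. 0 \<le> A $$ (i, j)) \<and>
     (\<forall>i i' j j'. i < i' \<and> i' < dim_row A \<and> j < j' \<and> j' < dim_col A \<longrightarrow>
        0 \<le> A $$ (i, j) * A $$ (i', j') - A $$ (i, j') * A $$ (i', j))"

end

theory Submission
  imports Defs
begin

text \<open>
  Let \<open>r i = h (d - i)\<close> be the reversed h-vector. The chain of inequalities says that \<open>h i / r i\<close> is
  monotone in \<open>i\<close>, that is, that the \<open>2 \<times> 2\<close> minors of the two-column matrix \<open>(h, r)\<close> have constant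
  sign. By Cauchy-Binet (\<open>TP2_pair_preserved\<close>) multiplication by a TP2 matrix \<open>H\<close> preserves this, and
  the symmetry \<open>H i j = H (d - i) (d - j)\<close> makes \<open>H r\<close> the reversal of \<open>H h\<close>, so that the minors of
  \<open>(H h, H r)\<close> are those in the conclusion. In the second part \<open>h 0 = 1\<close> and \<open>h d = 0\<close> extend the
  decreasing chain to the whole range \<open>0..d\<close>. Positivity of \<open>H h\<close> follows since \<open>H\<close> is
  nonnegative and invertible: row \<open>d\<close> is the last unit vector, and each other row, not being a multiple
  of it, has a positive entry before the last column.

  The geometric content lies in two facts about \<open>H\<close>: that it transforms the h-vector, and that it is
  symmetric. The open faces of a realized complex, by which the relative interiors of its faces are
  meant, partition its body. Therefore every face of the triangulation has a carrier, the smallest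
  face of \<open>\<Delta>\<close> that contains it. Counting faces by their carriers, with Moebius inversion to pass from closed to
  open faces, yields the transformation of f-vectors. The symmetry follows from a
  Dehn-Sommerville relation for the triangulated simplices: for a face \<open>\<tau>\<close> inside a face \<open>\<sigma>\<close>
  of \<open>\<Delta>\<close>, the alternating sum of the faces \<open>\<rho>\<close> that contain \<open>\<tau>\<close> and have carrier \<open>\<sigma>\<close> is
  \<open>(-1) ^ card \<sigma>\<close> (\<open>open_star_euler\<close>).

  This relation expresses that the open cell obtained by intersecting \<open>\<sigma>\<close> with a small ball around
  a point of \<open>\<tau>\<close> is partitioned into open cells belonging to these \<open>\<rho>\<close>. So all that is needed
  is the additivity of the Euler characteristic with compact supports on relatively open convex
  sets. Hadwiger's slicing argument proves it by induction on the dimension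
  (\<open>conv_euler_relation\<close>).
\<close>

section \<open>Additivity of the Euler characteristic of relatively open convex sets\<close>

text \<open>For a nonempty relatively open convex set, homeomorphic to a Euclidean space, this is the Euler
  characteristic with compact supports. The value \<open>0\<close> at the empty set lets a hyperplane
  that misses a set contribute nothing in the slicing argument below.\<close>

definition conv_euler :: "'e::euclidean_space set \<Rightarrow> real" where
  "conv_euler C = (if C = {} then 0 else (-1) ^ nat (aff_dim C))"

text \<open>A relatively open set is the trace of an open set \<open>U\<close> on its affine hull, and so its slice is
  the trace of the same \<open>U\<close> on a smaller affine space. In particular a slice that meets the set
  spans the whole slice of the affine hull, which gives its dimension.\<close>

lemma rel_open_Int_hyperplane:
  fixes C :: "'e::euclidean_space set"
  assumes C: "rel_open C" and ne: "C \<inter> {x. inner b x = t} \<noteq> {}"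
  shows "rel_open (C \<inter> {x. inner b x = t})"
    and "affine hull (C \<inter> {x. inner b x = t}) = affine hull C \<inter> {x. inner b x = t}"
proof -
  let ?H = "{x. inner b x = t}"
  from C obtain U where U: "open U" "C = affine hull C \<inter> U"
    unfolding rel_open openin_open by auto
  have aff: "affine (affine hull C \<inter> ?H)"
    by (intro affine_Int affine_hyperplane affine_affine_hull)
  have eq: "C \<inter> ?H = (affine hull C \<inter> ?H) \<inter> U"
    using U by blast
  show hull: "affine hull (C \<inter> ?H) = affine hull C \<inter> ?H"
    using affine_hull_affine_Int_open[OF aff \<open>open U\<close>] ne aff by (simp add: eq hull_same)
  show "rel_open (C \<inter> ?H)"
    unfolding rel_open hull openin_open using U eq by blast
qed

lemma conv_euler_Int_hyperplane:
  fixes C :: "'e::euclidean_space set"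
  assumes C: "rel_open C" and ne: "C \<inter> {x. inner b x = t} \<noteq> {}"
    and nsub: "\<not> C \<subseteq> {x. inner b x = t}"
  shows "conv_euler (C \<inter> {x. inner b x = t}) = - conv_euler C"
proof -
  let ?H = "{x. inner b x = t}"
  have ne': "affine hull C \<inter> ?H \<noteq> {}" and nsub': "\<not> affine hull C \<subseteq> ?H"
    using ne nsub hull_subset[of C affine] by blast+
  have "aff_dim (C \<inter> ?H) = aff_dim (affine hull C \<inter> ?H)"
    using rel_open_Int_hyperplane(2)[OF C ne] aff_dim_affine_hull by metis
  also have "\<dots> = aff_dim C - 1"
    using aff_dim_affine_Int_hyperplane[OF affine_affine_hull, of C b t] ne' nsub'
    by (simp add: aff_dim_affine_hull)
  finally have dim: "aff_dim (C \<inter> ?H) = aff_dim C - 1" .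
  moreover have "aff_dim (C \<inter> ?H) \<ge> 0"
    using ne aff_dim_negative_iff[of "C \<inter> ?H"] by linarith
  ultimately have "nat (aff_dim C) = Suc (nat (aff_dim (C \<inter> ?H)))"
    by linarith
  then show ?thesis
    using ne by (auto simp: conv_euler_def)
qed

lemma open_convex_bounded_real:
  fixes I :: "real set"
  assumes "open I" "convex I" "bounded I" "I \<noteq> {}"
  obtains a e where "a < e" "I = {a<..<e}"
proof -
  have conn: "connected I"
    using assms convex_connected by blast
  have bdd: "bdd_below I" "bdd_above I"
    using assms by (auto intro: bounded_imp_bdd_below bounded_imp_bdd_above)
  have no_min: "\<exists>y\<in>I. y < x" and no_max: "\<exists>y\<in>I. x < y" if x: "x \<in> I" for x
  proof -
    obtain r where r: "r > 0" "ball x r \<subseteq> I"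
      using assms(1) x open_contains_ball by blast
    have "x - r/2 \<in> ball x r" "x + r/2 \<in> ball x r"
      using r by (auto simp: dist_real_def)
    with r show "\<exists>y\<in>I. y < x" "\<exists>y\<in>I. x < y"
      by (metis half_gt_zero less_add_same_cancel1 diff_less_eq subsetD)+
  qed
  have "I = {Inf I<..<Sup I}"
  proof (intro equalityI subsetI)
    fix x assume "x \<in> I"
    with no_min no_max obtain y z where "y \<in> I" "z \<in> I" "y < x" "x < z"
      by blast
    with bdd show "x \<in> {Inf I<..<Sup I}"
      by (auto intro: le_less_trans[OF cInf_lower] less_le_trans[OF _ cSup_upper])
  next
    fix x assume x: "x \<in> {Inf I<..<Sup I}"
    obtain y z where "y \<in> I" "z \<in> I" "y < x" "x < z"
      using x assms(4) bdd by (auto simp: cInf_less_iff less_cSup_iff)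
    then show "x \<in> I"
      using conn connected_contains_Icc[of I y z] by auto
  qed
  moreover from this have "Inf I < Sup I"
    using assms(4) by (metis greaterThanLessThan_empty_iff not_less)
  ultimately show thesis using that by blast
qed

text \<open>As \<open>t\<close> varies, the slices at height \<open>t\<close> are nonempty over the projection of \<open>C\<close> to the
  direction \<open>b\<close>, which is either one point or an open interval; in the second case every slice
  loses one dimension, whence the sign. In the first case \<open>e\<close> is any number above \<open>a\<close>.\<close>

lemma conv_euler_slices:
  fixes C :: "'e::euclidean_space set"
  assumes C: "convex C" "rel_open C" "bounded C"
  obtains a e where "a < e"
    "(\<forall>t. conv_euler (C \<inter> {x. inner b x = t}) = (if t = a then conv_euler C else 0)) \<or>
     (\<forall>t. conv_euler (C \<inter> {x. inner b x = t}) = (if a < t \<and> t < e then - conv_euler C else 0))"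
proof (cases "\<exists>t. C \<subseteq> {x. inner b x = t}")
  case True
  then obtain a where a: "C \<subseteq> {x. inner b x = a}" by blast
  have "conv_euler (C \<inter> {x. inner b x = t}) = (if t = a then conv_euler C else 0)" for t
  proof (cases "t = a")
    case True
    then show ?thesis using a by (simp add: Int_absorb2)
  next
    case False
    then have "C \<inter> {x. inner b x = t} = {}" using a by auto
    then show ?thesis using False by (simp add: conv_euler_def)
  qed
  then show thesis using that[of a "a + 1"] by simp
next
  case False
  let ?I = "(inner b) ` C"
  have lin: "linear (inner b)"
    by (simp add: bounded_linear.linear bounded_linear_inner_right)
  have conv: "convex ?I"
    using C(1) convex_linear_image[OF lin] by blast
  have bnd: "bounded ?I"
    using C(3) bounded_linear_image bounded_linear_inner_right by blast
  have ne: "C \<noteq> {}" using False by blast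
  have "rel_interior ?I = ?I"
    using rel_interior_convex_linear_image[OF lin C(1)] C(2) by (simp add: rel_open_def)
  moreover have "interior ?I \<noteq> {}"
  proof -
    obtain x where x: "x \<in> C" using ne by blast
    obtain y where y: "y \<in> C" "inner b y \<noteq> inner b x"
      using False by blast
    then have "closed_segment (inner b x) (inner b y) \<subseteq> ?I"
      using conv x by (meson closed_segment_subset imageI)
    then have "open_segment (inner b x) (inner b y) \<subseteq> ?I"
      using open_closed_segment by blast
    moreover have "open (open_segment (inner b x) (inner b y))"
      by (simp add: open_segment_eq_real_ivl)
    moreover have "open_segment (inner b x) (inner b y) \<noteq> {}"
      using y by simp
    ultimately show ?thesis
      using interior_maximal by blast
  qed
  ultimately have "open ?I"
    using rel_interior_nonempty_interior open_interior by metis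
  then obtain a e where ae: "a < e" "?I = {a<..<e}"
    using open_convex_bounded_real conv bnd ne by (metis image_is_empty)
  have "conv_euler (C \<inter> {x. inner b x = t}) = (if a < t \<and> t < e then - conv_euler C else 0)" for t
  proof (cases "t \<in> ?I")
    case True
    then have "C \<inter> {x. inner b x = t} \<noteq> {}" by blast
    moreover have "a < t \<and> t < e" using True ae by simp
    ultimately show ?thesis
      using conv_euler_Int_hyperplane[OF C(2)] False by auto
  next
    case t: False
    then have "C \<inter> {x. inner b x = t} = {}" by blast
    moreover have "\<not> (a < t \<and> t < e)" using t ae by auto
    ultimately show ?thesis by (auto simp: conv_euler_def)
  qed
  then show thesis using that ae by blast
qed

text \<open>Integrating the slice values against the Euler characteristic of the line means summing the
  jumps \<open>s t - s (t+)\<close>. For a point the only jump is the value there. For an open interval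
  the value at the left end is \<open>0\<close> and the right limit is the negated Euler characteristic
  of \<open>C\<close>, whereas at the right end both vanish. Both cases yield the Euler characteristic of
  \<open>C\<close>. The right limit is replaced by the value at \<open>t + \<epsilon>\<close>, for an \<open>\<epsilon>\<close> smaller than every
  gap of a finite set \<open>T\<close> that contains the exceptional heights \<open>E\<close>, so that one choice of
  \<open>T\<close> and \<open>\<epsilon>\<close> serves finitely many sets at once.\<close>

lemma conv_euler_jumps:
  fixes C :: "'e::euclidean_space set"
  assumes "convex C" "rel_open C" "bounded C"
  shows "\<exists>E. finite E \<and> (\<forall>T \<epsilon>. finite T \<and> E \<subseteq> T \<and> \<epsilon> > 0 \<and>
           (\<forall>t\<in>T. \<forall>t'\<in>T. t < t' \<longrightarrow> t + \<epsilon> < t') \<longrightarrow>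
           (\<Sum>t\<in>T. conv_euler (C \<inter> {x. inner b x = t}) - conv_euler (C \<inter> {x. inner b x = t + \<epsilon>}))
           = conv_euler C)"
proof -
  let ?s = "\<lambda>t. conv_euler (C \<inter> {x. inner b x = t})"
  obtain a e where "a < e" and
    s: "(\<forall>t. ?s t = (if t = a then conv_euler C else 0)) \<or>
        (\<forall>t. ?s t = (if a < t \<and> t < e then - conv_euler C else 0))"
    by (rule conv_euler_slices[OF assms])
  show ?thesis
  proof (rule exI[of _ "{a, e}"], intro conjI allI impI)
    fix T :: "real set" and \<epsilon> :: real
    assume *: "finite T \<and> {a, e} \<subseteq> T \<and> \<epsilon> > 0 \<and> (\<forall>t\<in>T. \<forall>t'\<in>T. t < t' \<longrightarrow> t + \<epsilon> < t')"
    then have T: "finite T" "{a, e} \<subseteq> T" and \<epsilon>: "\<epsilon> > 0" by simp_all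
    have gap: "t + \<epsilon> < t'" if "t \<in> T" "t' \<in> T" "t < t'" for t t'
      using * that by simp
    have "?s t - ?s (t + \<epsilon>) = (if t = a then conv_euler C else 0)" if "t \<in> T" for t
    proof -
      have "a \<in> T" "e \<in> T" using T by auto
      then have 1: "t < a \<Longrightarrow> t + \<epsilon> < a" and 2: "t < e \<Longrightarrow> t + \<epsilon> < e"
        using gap that by blast+
      show ?thesis
        using s
      proof
        assume "\<forall>t. ?s t = (if t = a then conv_euler C else 0)"
        then have "?s t = (if t = a then conv_euler C else 0)"
          "?s (t + \<epsilon>) = (if t + \<epsilon> = a then conv_euler C else 0)" by blast+
        moreover have "t + \<epsilon> \<noteq> a" using 1 \<epsilon> by linarith
        ultimately show ?thesis by simp
      next
        assume "\<forall>t. ?s t = (if a < t \<and> t < e then - conv_euler C else 0)"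
        then have eqs: "?s t = (if a < t \<and> t < e then - conv_euler C else 0)"
          "?s (t + \<epsilon>) = (if a < t + \<epsilon> \<and> t + \<epsilon> < e then - conv_euler C else 0)" by blast+
        consider "t < a" "t + \<epsilon> < a" | "t = a" "t + \<epsilon> < e" | "a < t" "t + \<epsilon> < e" | "a < t" "e \<le> t"
          using 1 2 \<open>a < e\<close> by linarith
        then show ?thesis
          unfolding eqs using \<epsilon> \<open>a < e\<close> by cases simp_all
      qed
    qed
    then show "(\<Sum>t\<in>T. ?s t - ?s (t + \<epsilon>)) = conv_euler C"
      using T by simp
  qed simp
qed

lemma finite_set_real_gap:
  fixes T :: "real set"
  assumes "finite T"
  obtains \<epsilon> where "\<epsilon> > 0" "\<And>t t'. t \<in> T \<Longrightarrow> t' \<in> T \<Longrightarrow> t < t' \<Longrightarrow> t + \<epsilon> < t'"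
proof -
  define D where "D = insert 1 {r \<in> (\<lambda>(t, t'). t' - t) ` (T \<times> T). r > 0}"
  have fin: "finite D" using assms unfolding D_def by simp
  have "\<forall>x\<in>D. x > 0" "D \<noteq> {}" unfolding D_def by auto
  then have pos: "Min D > 0" using fin by simp
  have "t + Min D / 2 < t'" if "t \<in> T" "t' \<in> T" "t < t'" for t t'
  proof -
    have "t' - t \<in> (\<lambda>(t, t'). t' - t) ` (T \<times> T)" using that(1,2) by force
    then have "t' - t \<in> D" using that(3) unfolding D_def by simp
    then have "Min D \<le> t' - t" using fin by simp
    then show ?thesis using pos by linarith
  qed
  moreover have "Min D / 2 > 0" using pos by simp
  ultimately show thesis using that by blast
qed

text \<open>Every linear relation between indicator functions of bounded relatively open convex sets carries
  over to their Euler characteristics. In each slice the same relation holds between sets of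
  smaller dimension, so by induction the slice values satisfy it at every height; summing jumps, as
  in \<open>conv_euler_jumps\<close>, recovers the relation for the sets themselves.\<close>

theorem conv_euler_relation:
  fixes C :: "'k \<Rightarrow> 'e::euclidean_space set" and c :: "'k \<Rightarrow> real"
  assumes fin: "finite K"
    and cells: "\<And>k. k \<in> K \<Longrightarrow> convex (C k) \<and> rel_open (C k) \<and> bounded (C k)"
    and rel: "\<And>x. (\<Sum>k\<in>K. c k * indicator (C k) x) = 0"
  shows "(\<Sum>k\<in>K. c k * conv_euler (C k)) = 0"
proof -
  \<comment> \<open>\<open>B\<close> contains the coordinate directions in which the sets may still extend.\<close>
  have "(\<Sum>k\<in>K. c k * conv_euler (C k)) = 0"
    if "finite B" "B \<subseteq> Basis"
      "\<And>k. k \<in> K \<Longrightarrow> convex (C k) \<and> rel_open (C k) \<and> bounded (C k)"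
      "\<And>x. (\<Sum>k\<in>K. c k * indicator (C k) x) = 0"
      "\<And>x y i. x \<in> \<Union> (C ` K) \<Longrightarrow> y \<in> \<Union> (C ` K) \<Longrightarrow> i \<in> Basis - B \<Longrightarrow> inner i x = inner i y"
    for B and C :: "'k \<Rightarrow> 'e set"
    using that
  proof (induction B arbitrary: C rule: finite_induct)
    case empty
    show ?case
    proof (cases "\<Union> (C ` K) = {}")
      case True
      then show ?thesis by (simp add: conv_euler_def)
    next
      case False
      then obtain p where p: "p \<in> \<Union> (C ` K)"
        unfolding ex_in_conv[symmetric] by (rule exE)
      have "x = p" if "x \<in> \<Union> (C ` K)" for x
      proof (rule euclidean_eqI)
        fix i :: 'e assume "i \<in> Basis"
        then have "inner i x = inner i p" using empty.prems(4)[OF that p, of i] by simp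
        then show "inner x i = inner p i" by (simp add: inner_commute)
      qed
      then have sub: "C k \<subseteq> {p}" if "k \<in> K" for k using that by blast
      have "conv_euler (C k) = indicator (C k) p" if "k \<in> K" for k
      proof (cases "C k = {}")
        case True
        then show ?thesis by (simp add: conv_euler_def)
      next
        case False
        then have "C k = {p}" using sub[OF that] by blast
        then show ?thesis by (simp add: conv_euler_def)
      qed
      then show ?thesis using empty.prems(3)[of p] by simp
    qed
  next
    case (insert b B)
    let ?H = "\<lambda>t. {x. inner b x = t}"
    have slice: "(\<Sum>k\<in>K. c k * conv_euler (C k \<inter> ?H t)) = 0" for t
    proof (rule insert.IH)
      show "B \<subseteq> Basis" using insert.prems(1) by blast
      show "convex (C k \<inter> ?H t) \<and> rel_open (C k \<inter> ?H t) \<and> bounded (C k \<inter> ?H t)"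
        if "k \<in> K" for k
      proof (intro conjI)
        show "convex (C k \<inter> ?H t)"
          using insert.prems(2)[OF that] by (intro convex_Int convex_hyperplane) auto
        show "rel_open (C k \<inter> ?H t)"
          using insert.prems(2)[OF that] rel_open_Int_hyperplane(1)[of "C k" b t]
          by (cases "C k \<inter> ?H t = {}") (auto simp: rel_open_def)
        show "bounded (C k \<inter> ?H t)"
          using insert.prems(2)[OF that] by (auto intro: bounded_Int)
      qed
      show "(\<Sum>k\<in>K. c k * indicator (C k \<inter> ?H t) x) = 0" for x
      proof -
        have "(\<Sum>k\<in>K. c k * indicator (C k \<inter> ?H t) x) =
              (\<Sum>k\<in>K. c k * indicator (C k) x) * indicator (?H t) x"
          by (simp add: indicator_inter_arith sum_distrib_right mult.assoc)
        then show ?thesis using insert.prems(3)[of x] by simp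
      qed
      show "inner i x = inner i y"
        if "x \<in> (\<Union>k\<in>K. C k \<inter> ?H t)" "y \<in> (\<Union>k\<in>K. C k \<inter> ?H t)" "i \<in> Basis - B" for x y i
        using that insert.prems(4)[of x y i] by (cases "i = b") auto
    qed
    have "\<exists>E. finite E \<and> (\<forall>T \<epsilon>. finite T \<and> E \<subseteq> T \<and> \<epsilon> > 0 \<and>
             (\<forall>t\<in>T. \<forall>t'\<in>T. t < t' \<longrightarrow> t + \<epsilon> < t') \<longrightarrow>
             (\<Sum>t\<in>T. conv_euler (C k \<inter> ?H t) - conv_euler (C k \<inter> ?H (t + \<epsilon>)))
             = conv_euler (C k))" if k: "k \<in> K" for k
      using insert.prems(2)[OF k] by (intro conv_euler_jumps) simp_all
    then have "\<forall>k\<in>K. \<exists>E. finite E \<and> (\<forall>T \<epsilon>. finite T \<and> E \<subseteq> T \<and> \<epsilon> > 0 \<and>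
             (\<forall>t\<in>T. \<forall>t'\<in>T. t < t' \<longrightarrow> t + \<epsilon> < t') \<longrightarrow>
             (\<Sum>t\<in>T. conv_euler (C k \<inter> ?H t) - conv_euler (C k \<inter> ?H (t + \<epsilon>)))
             = conv_euler (C k))" by (rule ballI)
    from bchoice[OF this] obtain E where E: "\<forall>k\<in>K. finite (E k) \<and> (\<forall>T \<epsilon>. finite T \<and> E k \<subseteq> T \<and> \<epsilon> > 0 \<and>
             (\<forall>t\<in>T. \<forall>t'\<in>T. t < t' \<longrightarrow> t + \<epsilon> < t') \<longrightarrow>
             (\<Sum>t\<in>T. conv_euler (C k \<inter> ?H t) - conv_euler (C k \<inter> ?H (t + \<epsilon>)))
             = conv_euler (C k))" by (rule exE)
    define T where "T = \<Union> (E ` K)"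
    have T: "finite T" using E fin unfolding T_def by simp
    obtain \<epsilon> where \<epsilon>: "\<epsilon> > 0" "\<And>t t'. t \<in> T \<Longrightarrow> t' \<in> T \<Longrightarrow> t < t' \<Longrightarrow> t + \<epsilon> < t'"
      by (rule finite_set_real_gap[OF T]) blast
    have E': "conv_euler (C k) =
        (\<Sum>t\<in>T. conv_euler (C k \<inter> ?H t) - conv_euler (C k \<inter> ?H (t + \<epsilon>)))" if "k \<in> K" for k
    proof -
      have "E k \<subseteq> T" using that unfolding T_def by (rule UN_upper)
      then have "finite T \<and> E k \<subseteq> T \<and> \<epsilon> > 0 \<and> (\<forall>t\<in>T. \<forall>t'\<in>T. t < t' \<longrightarrow> t + \<epsilon> < t')"
        using T \<epsilon> by (intro conjI ballI impI)
      with bspec[OF E that] show ?thesis by simp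
    qed
    have "(\<Sum>k\<in>K. c k * conv_euler (C k)) =
          (\<Sum>k\<in>K. c k * (\<Sum>t\<in>T. conv_euler (C k \<inter> ?H t) - conv_euler (C k \<inter> ?H (t + \<epsilon>))))"
      by (intro sum.cong refl arg_cong2[of _ _ _ _ "(*)"] E')
    also have "\<dots> = (\<Sum>t\<in>T. \<Sum>k\<in>K. c k * conv_euler (C k \<inter> ?H t)
                                     - c k * conv_euler (C k \<inter> ?H (t + \<epsilon>)))"
      unfolding sum_distrib_left right_diff_distrib by (rule sum.swap)
    also have "\<dots> = 0"
      by (simp add: sum_subtractf slice)
    finally show ?case .
  qed
  from this[OF finite_Basis subset_refl cells rel] show ?thesis by simp
qed

lemma rel_open_Int_open:
  fixes S :: "'e::euclidean_space set"
  assumes S: "rel_open S" "convex S" and U: "open U"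
  shows "rel_open (S \<inter> U)"
proof (cases "S \<inter> U = {}")
  case False
  obtain V where V: "open V" "S = affine hull S \<inter> V"
    using S(1) unfolding rel_open openin_open by auto
  have "affine hull (S \<inter> U) = affine hull S"
    using affine_hull_convex_Int_open[OF S(2) U False] .
  moreover have "S \<inter> U = affine hull S \<inter> (V \<inter> U)" using V(2) by blast
  ultimately show ?thesis
    unfolding rel_open openin_open using open_Int[OF V(1) U] by auto
qed (simp add: rel_open_def)

lemma conv_euler_Int_open:
  fixes S :: "'e::euclidean_space set"
  assumes "convex S" "open U" "S \<inter> U \<noteq> {}"
  shows "conv_euler (S \<inter> U) = (-1) ^ nat (aff_dim S)"
  using affine_hull_convex_Int_open[OF assms] assms(3)
  by (simp add: conv_euler_def) (metis aff_dim_affine_hull)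

text \<open>Removing a closed set of smaller dimension leaves a dense relatively open set with the same
  affine hull, so the removal can be repeated.\<close>

lemma rel_open_not_covered:
  fixes S :: "'e::euclidean_space set"
  assumes "finite \<T>" "rel_open S" "S \<noteq> {}" "\<And>T. T \<in> \<T> \<Longrightarrow> closed T \<and> aff_dim T < aff_dim S"
  shows "\<not> S \<subseteq> \<Union>\<T>"
proof -
  have "openin (top_of_set (affine hull S)) (S - \<Union>\<T>) \<and> closure (S - \<Union>\<T>) = closure S"
    using assms(1,4)
  proof (induction \<T> rule: finite_induct)
    case empty
    then show ?case using assms(2) by (simp add: rel_open)
  next
    case (insert T \<T>)
    let ?R = "S - \<Union>\<T>"
    have IH: "openin (top_of_set (affine hull S)) ?R" "closure ?R = closure S"
      using insert.IH insert.prems by simp_all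
    have hull: "affine hull ?R = affine hull S"
      using IH(2) by (metis closure_same_affine_hull)
    have "aff_dim ?R = aff_dim S"
      using aff_dim_affine_hull[of ?R] aff_dim_affine_hull[of S] unfolding hull by simp
    then have T: "closed T" "aff_dim T < aff_dim ?R"
      using insert.prems[of T] by simp_all
    have eq: "S - \<Union>(insert T \<T>) = ?R - T" by auto
    have "closure (?R - T) = closure S"
      using dense_complement_openin_affine_hull[OF T(2)] IH hull by simp
    moreover have "openin (top_of_set (affine hull S)) (?R \<inter> - T)"
      using IH(1) T(1) by (intro openin_Int_open) (simp_all add: open_Compl)
    moreover have "?R \<inter> - T = ?R - T" by blast
    ultimately show ?case unfolding eq by simp
  qed
  then have "closure (S - \<Union>\<T>) \<noteq> {}" using assms(3) by simp
  then show ?thesis by auto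
qed

section \<open>Open faces of a realized complex\<close>

text \<open>The vertices with nonzero barycentric coordinate span the face in question.\<close>

lemma rel_interior_subface_exists:
  fixes S :: "'e::euclidean_space set"
  assumes aff: "\<not> affine_dependent S" and x: "x \<in> convex hull S"
  shows "\<exists>T\<subseteq>S. x \<in> rel_interior (convex hull T)"
proof -
  have fin: "finite S" using aff aff_independent_finite by blast
  then obtain u where u: "\<forall>y\<in>S. 0 \<le> u y" "sum u S = 1" "(\<Sum>y\<in>S. u y *\<^sub>R y) = x"
    using x unfolding convex_hull_finite[OF fin] by blast
  let ?T = "{y \<in> S. u y \<noteq> 0}"
  have "sum u ?T = 1" "(\<Sum>y\<in>?T. u y *\<^sub>R y) = x"
    using u(2,3) fin by (auto intro!: sum.mono_neutral_left simp flip: u(2,3))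
  moreover have "\<forall>y\<in>?T. 0 < u y" using u(1) by (simp add: less_le)
  moreover have "\<not> affine_dependent ?T"
    using aff affine_dependent_subset[of ?T S] by blast
  ultimately have "x \<in> rel_interior (convex hull ?T)"
    by (simp add: rel_interior_convex_hull_explicit) blast
  then show ?thesis by (intro exI[of _ ?T]) auto
qed

lemma convex_hull_eq_affine_independent:
  fixes S T :: "'e::euclidean_space set"
  assumes "\<not> affine_dependent S" "\<not> affine_dependent T" "convex hull S = convex hull T"
  shows "S = T"
  using assms extreme_point_of_convex_hull_affine_independent by (metis subset_antisym subsetI)

locale realized_complex =
  fixes \<Delta> :: "'a set set" and \<phi> :: "'a \<Rightarrow> 'e::euclidean_space"
  assumes complex: "abstract_simplicial_complex \<Delta>"
    and realization: "geometric_realization \<Delta> \<phi>"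
begin

lemma finite_complex: "finite \<Delta>"
  and finite_face: "\<sigma> \<in> \<Delta> \<Longrightarrow> finite \<sigma>"
  and empty_face: "{} \<in> \<Delta>"
  and subface: "\<sigma> \<in> \<Delta> \<Longrightarrow> \<tau> \<subseteq> \<sigma> \<Longrightarrow> \<tau> \<in> \<Delta>"
  using complex unfolding abstract_simplicial_complex_def by blast+

lemma inj_on_face: "\<sigma> \<in> \<Delta> \<Longrightarrow> inj_on \<phi> \<sigma>"
  using realization unfolding geometric_realization_def by (meson Union_upper inj_on_subset)

lemma affine_independent_face: "\<sigma> \<in> \<Delta> \<Longrightarrow> \<not> affine_dependent (\<phi> ` \<sigma>)"
  using realization unfolding geometric_realization_def by blast

lemma aff_dim_face_body: "\<sigma> \<in> \<Delta> \<Longrightarrow> aff_dim (face_body \<phi> \<sigma>) = int (card \<sigma>) - 1"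
  using aff_dim_affine_independent[OF affine_independent_face[of \<sigma>]] inj_on_face[of \<sigma>]
  by (simp add: face_body_def aff_dim_convex_hull card_image)

lemma convex_face_body: "convex (face_body \<phi> \<sigma>)"
  by (simp add: face_body_def)

lemma compact_face_body: "\<sigma> \<in> \<Delta> \<Longrightarrow> compact (face_body \<phi> \<sigma>)"
  by (simp add: face_body_def finite_face finite_imp_compact_convex_hull)

lemma face_body_mono: "\<tau> \<subseteq> \<sigma> \<Longrightarrow> face_body \<phi> \<tau> \<subseteq> face_body \<phi> \<sigma>"
  unfolding face_body_def by (simp add: hull_mono image_mono)

lemma face_body_empty_iff: "face_body \<phi> \<sigma> = {} \<longleftrightarrow> \<sigma> = {}"
  by (simp add: face_body_def)

lemma rel_interior_face_body_nonempty: "\<sigma> \<noteq> {} \<Longrightarrow> rel_interior (face_body \<phi> \<sigma>) \<noteq> {}"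
  by (simp add: rel_interior_eq_empty convex_face_body face_body_empty_iff)

lemma point_in_open_face:
  assumes "\<sigma> \<in> \<Delta>" "x \<in> face_body \<phi> \<sigma>"
  shows "\<exists>\<tau>\<subseteq>\<sigma>. x \<in> rel_interior (face_body \<phi> \<tau>)"
proof -
  obtain T where "T \<subseteq> \<phi> ` \<sigma>" "x \<in> rel_interior (convex hull T)"
    using rel_interior_subface_exists[OF affine_independent_face[OF assms(1)]] assms(2)
    unfolding face_body_def by blast
  moreover from this obtain \<tau> where "\<tau> \<subseteq> \<sigma>" "T = \<phi> ` \<tau>" by (meson subset_imageE)
  ultimately show ?thesis unfolding face_body_def by blast
qed

text \<open>The two bodies meet in a common face. If that face contains a point of the relative interior of
  \<open>\<tau>\<close>, it is all of \<open>\<tau>\<close>; so the body of \<open>\<tau>\<close> is a face of the simplex of \<open>\<sigma>\<close>, hence spanned by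
  some of its vertices, which are its extreme points and therefore determined by the body.\<close>

lemma open_face_meets_face:
  assumes \<tau>: "\<tau> \<in> \<Delta>" and \<sigma>: "\<sigma> \<in> \<Delta>"
    and x: "x \<in> rel_interior (face_body \<phi> \<tau>)" "x \<in> face_body \<phi> \<sigma>"
  shows "\<tau> \<subseteq> \<sigma>"
proof -
  let ?B = "face_body \<phi>"
  have face: "(?B \<sigma> \<inter> ?B \<tau>) face_of ?B \<sigma>" "(?B \<tau> \<inter> ?B \<sigma>) face_of ?B \<tau>"
    using realization \<tau> \<sigma> unfolding geometric_realization_def simplicial_complex_def by blast+
  have "x \<in> ?B \<tau>" using x(1) rel_interior_subset by blast
  then have "?B \<tau> \<subseteq> ?B \<tau> \<inter> ?B \<sigma>"
    using subset_of_face_of[OF face(2) subset_refl] x by blast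
  then have "?B \<tau> face_of ?B \<sigma>" using face(1) by (simp add: Int_absorb1)
  then obtain c where c: "c \<subseteq> \<phi> ` \<sigma>" "?B \<tau> = convex hull c"
    using face_of_convex_hull_affine_independent[OF affine_independent_face[OF \<sigma>]]
    unfolding face_body_def by blast
  have "\<not> affine_dependent c"
    using c(1) affine_independent_face[OF \<sigma>] affine_dependent_subset by blast
  then have "\<phi> ` \<tau> = c"
    using convex_hull_eq_affine_independent[OF affine_independent_face[OF \<tau>]] c(2)
    unfolding face_body_def by blast
  then have "\<phi> ` \<tau> \<subseteq> \<phi> ` \<sigma>" using c(1) by simp
  moreover have "inj_on \<phi> (\<Union>\<Delta>)"
    using realization unfolding geometric_realization_def by blast
  ultimately show ?thesis
    using \<tau> \<sigma> by (simp add: inj_on_image_subset_iff Union_upper)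
qed

lemma open_faces_disjoint:
  assumes "\<tau> \<in> \<Delta>" "\<sigma> \<in> \<Delta>"
    "x \<in> rel_interior (face_body \<phi> \<tau>)" "x \<in> rel_interior (face_body \<phi> \<sigma>)"
  shows "\<tau> = \<sigma>"
  using open_face_meets_face[OF assms(1,2,3)] open_face_meets_face[OF assms(2,1,4)] assms(3,4)
    rel_interior_subset by blast

end

section \<open>Carriers of the faces of a subdivision\<close>

locale geometric_subdivision = coarse: realized_complex \<Delta> \<phi> + fine: realized_complex \<Delta>' \<psi>
  for \<Delta> :: "'a set set" and \<phi> :: "'a \<Rightarrow> 'e::euclidean_space"
    and \<Delta>' :: "'b set set" and \<psi> :: "'b \<Rightarrow> 'e" +
  assumes same_body: "(\<Union>\<sigma>\<in>\<Delta>. face_body \<phi> \<sigma>) = (\<Union>\<tau>\<in>\<Delta>'. face_body \<psi> \<tau>)"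
    and face_covered: "\<sigma> \<in> \<Delta> \<Longrightarrow> \<exists>S\<subseteq>\<Delta>'. face_body \<phi> \<sigma> = (\<Union>\<tau>\<in>S. face_body \<psi> \<tau>)"
begin

lemma face_body_covered:
  assumes "\<sigma> \<in> \<Delta>" "x \<in> face_body \<phi> \<sigma>"
  shows "\<exists>\<tau>\<in>\<Delta>'. face_body \<psi> \<tau> \<subseteq> face_body \<phi> \<sigma> \<and> x \<in> face_body \<psi> \<tau>"
  using face_covered[OF assms(1)] assms(2) by blast

text \<open>The body of \<open>\<sigma>\<close> is a union of fine faces, and the one through \<open>x\<close> must have \<open>\<tau>\<close> as a face.\<close>

lemma open_face_inside:
  assumes \<sigma>: "\<sigma> \<in> \<Delta>" and \<tau>: "\<tau> \<in> \<Delta>'"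
    and x: "x \<in> rel_interior (face_body \<psi> \<tau>)" "x \<in> face_body \<phi> \<sigma>"
  shows "face_body \<psi> \<tau> \<subseteq> face_body \<phi> \<sigma>"
proof -
  obtain \<rho> where \<rho>: "\<rho> \<in> \<Delta>'" "face_body \<psi> \<rho> \<subseteq> face_body \<phi> \<sigma>" "x \<in> face_body \<psi> \<rho>"
    using face_body_covered[OF \<sigma> x(2)] by blast
  have "\<tau> \<subseteq> \<rho>" using fine.open_face_meets_face[OF \<tau> \<rho>(1) x(1) \<rho>(3)] .
  then show ?thesis using fine.face_body_mono \<rho>(2) by blast
qed

text \<open>Any point in the relative interior of \<open>\<tau>\<close> lies in exactly one open face \<open>\<kappa>\<close> of the coarse
  complex. The stated equivalence shows that \<open>\<kappa>\<close> does not depend on the point, so that the whole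
  open face \<open>\<tau>\<close> lies in the open face \<open>\<kappa>\<close>. For the empty face the carrier is the empty face.\<close>

lemma carrier_exists:
  assumes \<tau>: "\<tau> \<in> \<Delta>'"
  shows "\<exists>\<kappa>\<in>\<Delta>. (\<forall>\<sigma>\<in>\<Delta>. face_body \<psi> \<tau> \<subseteq> face_body \<phi> \<sigma> \<longleftrightarrow> \<kappa> \<subseteq> \<sigma>) \<and>
    rel_interior (face_body \<psi> \<tau>) \<subseteq> rel_interior (face_body \<phi> \<kappa>)"
proof (cases "\<tau> = {}")
  case True
  then show ?thesis using coarse.empty_face by (intro bexI[of _ "{}"]) (simp_all add: face_body_def)
next
  case False
  have pt: "\<exists>\<kappa>\<in>\<Delta>. x \<in> rel_interior (face_body \<phi> \<kappa>) \<and>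
      (\<forall>\<sigma>\<in>\<Delta>. face_body \<psi> \<tau> \<subseteq> face_body \<phi> \<sigma> \<longleftrightarrow> \<kappa> \<subseteq> \<sigma>)"
    if x: "x \<in> rel_interior (face_body \<psi> \<tau>)" for x
  proof -
    have x': "x \<in> face_body \<psi> \<tau>" using x rel_interior_subset by blast
    then obtain \<sigma>0 where "\<sigma>0 \<in> \<Delta>" "x \<in> face_body \<phi> \<sigma>0"
      using same_body \<tau> by blast
    then obtain \<kappa> where \<kappa>: "\<kappa> \<in> \<Delta>" "x \<in> rel_interior (face_body \<phi> \<kappa>)"
      using coarse.point_in_open_face coarse.subface by blast
    have sub: "face_body \<psi> \<tau> \<subseteq> face_body \<phi> \<kappa>"
      using open_face_inside[OF \<kappa>(1) \<tau> x] \<kappa>(2) rel_interior_subset by blast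
    have "face_body \<psi> \<tau> \<subseteq> face_body \<phi> \<sigma> \<longleftrightarrow> \<kappa> \<subseteq> \<sigma>" if "\<sigma> \<in> \<Delta>" for \<sigma>
      using coarse.open_face_meets_face[OF \<kappa>(1) that \<kappa>(2)] x' sub coarse.face_body_mono[of \<kappa> \<sigma>]
      by blast
    then show ?thesis using \<kappa> by blast
  qed
  obtain x where "x \<in> rel_interior (face_body \<psi> \<tau>)"
    using fine.rel_interior_face_body_nonempty[OF False] by blast
  from pt[OF this] obtain \<kappa> where \<kappa>: "\<kappa> \<in> \<Delta>"
    "\<forall>\<sigma>\<in>\<Delta>. face_body \<psi> \<tau> \<subseteq> face_body \<phi> \<sigma> \<longleftrightarrow> \<kappa> \<subseteq> \<sigma>" by blast
  have "y \<in> rel_interior (face_body \<phi> \<kappa>)" if y: "y \<in> rel_interior (face_body \<psi> \<tau>)" for y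
  proof -
    from pt[OF y] obtain \<kappa>' where \<kappa>': "\<kappa>' \<in> \<Delta>" "y \<in> rel_interior (face_body \<phi> \<kappa>')"
      "\<forall>\<sigma>\<in>\<Delta>. face_body \<psi> \<tau> \<subseteq> face_body \<phi> \<sigma> \<longleftrightarrow> \<kappa>' \<subseteq> \<sigma>" by blast
    have "\<kappa>' = \<kappa>" using \<kappa> \<kappa>'(1,3) by (meson subset_antisym subset_refl)
    then show ?thesis using \<kappa>'(2) by simp
  qed
  then show ?thesis using \<kappa> by blast
qed

definition carrier_face :: "'b set \<Rightarrow> 'a set" where
  "carrier_face \<tau> = (SOME \<kappa>. \<kappa> \<in> \<Delta> \<and> (\<forall>\<sigma>\<in>\<Delta>. face_body \<psi> \<tau> \<subseteq> face_body \<phi> \<sigma> \<longleftrightarrow> \<kappa> \<subseteq> \<sigma>) \<and>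
    rel_interior (face_body \<psi> \<tau>) \<subseteq> rel_interior (face_body \<phi> \<kappa>))"

lemma
  assumes "\<tau> \<in> \<Delta>'"
  shows carrier_in: "carrier_face \<tau> \<in> \<Delta>"
    and carrier_subset_iff: "\<sigma> \<in> \<Delta> \<Longrightarrow> carrier_face \<tau> \<subseteq> \<sigma> \<longleftrightarrow> face_body \<psi> \<tau> \<subseteq> face_body \<phi> \<sigma>"
    and rel_interior_carrier:
      "rel_interior (face_body \<psi> \<tau>) \<subseteq> rel_interior (face_body \<phi> (carrier_face \<tau>))"
proof -
  have "\<exists>\<kappa>. \<kappa> \<in> \<Delta> \<and> (\<forall>\<sigma>\<in>\<Delta>. face_body \<psi> \<tau> \<subseteq> face_body \<phi> \<sigma> \<longleftrightarrow> \<kappa> \<subseteq> \<sigma>) \<and>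
      rel_interior (face_body \<psi> \<tau>) \<subseteq> rel_interior (face_body \<phi> \<kappa>)"
    using carrier_exists[OF assms] by blast
  from someI_ex[OF this, folded carrier_face_def]
  show "carrier_face \<tau> \<in> \<Delta>" "\<sigma> \<in> \<Delta> \<Longrightarrow> carrier_face \<tau> \<subseteq> \<sigma> \<longleftrightarrow> face_body \<psi> \<tau> \<subseteq> face_body \<phi> \<sigma>"
    "rel_interior (face_body \<psi> \<tau>) \<subseteq> rel_interior (face_body \<phi> (carrier_face \<tau>))"
    by blast+
qed

lemma carrier_empty: "carrier_face {} = {}"
  using carrier_subset_iff[OF fine.empty_face coarse.empty_face] by (simp add: face_body_def)

lemma card_le_carrier:
  assumes "\<tau> \<in> \<Delta>'"
  shows "card \<tau> \<le> card (carrier_face \<tau>)"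
proof -
  have "aff_dim (face_body \<psi> \<tau>) \<le> aff_dim (face_body \<phi> (carrier_face \<tau>))"
    using carrier_subset_iff[OF assms carrier_in[OF assms]] by (intro aff_dim_subset) simp
  then show ?thesis
    using fine.aff_dim_face_body[OF assms] coarse.aff_dim_face_body[OF carrier_in[OF assms]] by simp
qed

lemma carrier_mono:
  assumes "\<rho> \<in> \<Delta>'" "\<tau> \<subseteq> \<rho>"
  shows "carrier_face \<tau> \<subseteq> carrier_face \<rho>"
proof -
  have \<tau>: "\<tau> \<in> \<Delta>'" using assms fine.subface by blast
  have "face_body \<psi> \<rho> \<subseteq> face_body \<phi> (carrier_face \<rho>)"
    using carrier_subset_iff[OF assms(1) carrier_in[OF assms(1)]] by simp
  then show ?thesis
    using carrier_subset_iff[OF \<tau> carrier_in[OF assms(1)]] fine.face_body_mono[OF assms(2)] by blast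
qed

text \<open>With \<open>rel_interior_carrier\<close> and the disjointness of open faces, this says that the open fine
  faces with carrier \<open>\<sigma>\<close> partition the relative interior of \<open>\<sigma>\<close>.\<close>

lemma rel_interior_partition:
  assumes \<sigma>: "\<sigma> \<in> \<Delta>" and x: "x \<in> rel_interior (face_body \<phi> \<sigma>)"
  shows "\<exists>\<rho>\<in>\<Delta>'. carrier_face \<rho> = \<sigma> \<and> x \<in> rel_interior (face_body \<psi> \<rho>)"
proof -
  have "x \<in> face_body \<phi> \<sigma>" using x rel_interior_subset by blast
  then obtain \<tau> where "\<tau> \<in> \<Delta>'" "x \<in> face_body \<psi> \<tau>" using \<sigma> same_body by blast
  then obtain \<rho> where \<rho>: "\<rho> \<in> \<Delta>'" "x \<in> rel_interior (face_body \<psi> \<rho>)"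
    using fine.point_in_open_face fine.subface by blast
  have "carrier_face \<rho> = \<sigma>"
    using coarse.open_faces_disjoint[OF carrier_in[OF \<rho>(1)] \<sigma>] rel_interior_carrier[OF \<rho>(1)] \<rho>(2) x
    by blast
  then show ?thesis using \<rho> by blast
qed

end

section \<open>The Euler relation for open stars\<close>

context geometric_subdivision
begin

text \<open>The open faces with carrier \<open>\<sigma>\<close> cover the relative interior of \<open>\<sigma>\<close>, which is impossible if all
  of them have smaller dimension.\<close>

lemma carrier_full_dim_exists:
  assumes \<sigma>: "\<sigma> \<in> \<Delta>"
  shows "\<exists>\<rho>\<in>\<Delta>'. carrier_face \<rho> = \<sigma> \<and> card \<rho> = card \<sigma>"
proof (cases "\<sigma> = {}")
  case True
  then show ?thesis using carrier_empty fine.empty_face by (intro bexI[of _ "{}"]) simp_all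
next
  case False
  let ?S = "rel_interior (face_body \<phi> \<sigma>)"
  let ?R = "{\<rho> \<in> \<Delta>'. carrier_face \<rho> = \<sigma>}"
  have "?S \<subseteq> \<Union>(face_body \<psi> ` ?R)"
  proof
    fix x assume "x \<in> ?S"
    from rel_interior_partition[OF \<sigma> this] show "x \<in> \<Union>(face_body \<psi> ` ?R)"
      using rel_interior_subset by fastforce
  qed
  moreover have "finite (face_body \<psi> ` ?R)" using fine.finite_complex by simp
  moreover have "rel_open ?S" by (simp add: rel_interior_rel_open coarse.convex_face_body)
  moreover have "?S \<noteq> {}" using coarse.rel_interior_face_body_nonempty[OF False] .
  ultimately obtain T where "T \<in> face_body \<psi> ` ?R" "\<not> (closed T \<and> aff_dim T < aff_dim ?S)"
    using rel_open_not_covered[of "face_body \<psi> ` ?R" ?S] by blast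
  then obtain \<rho> where \<rho>: "\<rho> \<in> \<Delta>'" "carrier_face \<rho> = \<sigma>"
    "\<not> (closed (face_body \<psi> \<rho>) \<and> aff_dim (face_body \<psi> \<rho>) < aff_dim ?S)"
    by blast
  have "card \<sigma> \<le> card \<rho>"
    using \<rho> fine.compact_face_body[OF \<rho>(1)] fine.aff_dim_face_body[OF \<rho>(1)]
      coarse.aff_dim_face_body[OF \<sigma>]
    by (simp add: compact_imp_closed rel_interior_aff_dim coarse.convex_face_body)
  then show ?thesis using \<rho> card_le_carrier[OF \<rho>(1)] by (intro bexI[of _ \<rho>]) simp_all
qed

text \<open>A small ball around a point of the open face \<open>\<tau>\<close> meets exactly the open faces that have \<open>\<tau>\<close> as a
  face. For \<open>\<tau> = {}\<close> the whole space plays the role of the ball.\<close>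

lemma star_neighbourhood:
  assumes \<sigma>: "\<sigma> \<in> \<Delta>" and \<tau>: "\<tau> \<in> \<Delta>'" and sub: "carrier_face \<tau> \<subseteq> \<sigma>" and ne: "\<sigma> \<noteq> {}"
  obtains U where "open U" "convex U" "rel_interior (face_body \<phi> \<sigma>) \<inter> U \<noteq> {}"
    "\<And>\<rho>. \<rho> \<in> \<Delta>' \<Longrightarrow> \<rho> \<noteq> {} \<Longrightarrow> rel_interior (face_body \<psi> \<rho>) \<inter> U \<noteq> {} \<longleftrightarrow> \<tau> \<subseteq> \<rho>"
proof (cases "\<tau> = {}")
  case True
  show thesis
    by (rule that[of UNIV])
      (use True ne coarse.rel_interior_face_body_nonempty fine.rel_interior_face_body_nonempty in auto)
next
  case False
  obtain p where p: "p \<in> rel_interior (face_body \<psi> \<tau>)"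
    using fine.rel_interior_face_body_nonempty[OF False] by blast
  then have p': "p \<in> face_body \<psi> \<tau>" using rel_interior_subset by blast
  let ?A = "\<Union>(face_body \<psi> ` {\<rho> \<in> \<Delta>'. p \<notin> face_body \<psi> \<rho>})"
  have "closed ?A"
    using fine.finite_complex fine.compact_face_body by (intro closed_Union) (auto intro: compact_imp_closed)
  then have "open (- ?A)" by (rule open_Compl)
  moreover have "p \<in> - ?A" by blast
  ultimately obtain r where r: "r > 0" "ball p r \<subseteq> - ?A"
    by (rule openE)
  have meets: "rel_interior C \<inter> ball p r \<noteq> {}" if "convex C" "closed C" "p \<in> C" for C
  proof -
    have "p \<in> closure (rel_interior C)"
      using that by (simp add: convex_closure_rel_interior closure_closed)
    moreover have "p \<in> ball p r" using r(1) by simp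
    ultimately show ?thesis using open_Int_closure_eq_empty[OF open_ball, of p r "rel_interior C"] by blast
  qed
  show thesis
  proof (rule that[of "ball p r"])
    have "p \<in> face_body \<phi> \<sigma>" using carrier_subset_iff[OF \<tau> \<sigma>] sub p' by blast
    then show "rel_interior (face_body \<phi> \<sigma>) \<inter> ball p r \<noteq> {}"
      using coarse.convex_face_body coarse.compact_face_body[OF \<sigma>] compact_imp_closed by (intro meets) auto
    fix \<rho> assume \<rho>: "\<rho> \<in> \<Delta>'" "\<rho> \<noteq> {}"
    show "rel_interior (face_body \<psi> \<rho>) \<inter> ball p r \<noteq> {} \<longleftrightarrow> \<tau> \<subseteq> \<rho>"
    proof
      assume "rel_interior (face_body \<psi> \<rho>) \<inter> ball p r \<noteq> {}"
      then have "p \<in> face_body \<psi> \<rho>" using \<rho>(1) r(2) rel_interior_subset by blast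
      then show "\<tau> \<subseteq> \<rho>" using fine.open_face_meets_face[OF \<tau> \<rho>(1) p] by blast
    next
      assume "\<tau> \<subseteq> \<rho>"
      then have "p \<in> face_body \<psi> \<rho>" using fine.face_body_mono p' by blast
      then show "rel_interior (face_body \<psi> \<rho>) \<inter> ball p r \<noteq> {}"
        using fine.convex_face_body fine.compact_face_body[OF \<rho>(1)] compact_imp_closed by (intro meets) auto
    qed
  qed simp_all
qed

text \<open>This is the local form of the Dehn-Sommerville relations. Let \<open>U\<close> be the neighbourhood from
  \<open>star_neighbourhood\<close>. The relatively open convex set \<open>rel_interior \<sigma> \<inter> U\<close>, of the dimension of
  \<open>\<sigma>\<close>, is partitioned into the sets \<open>rel_interior \<rho> \<inter> U\<close> for the faces \<open>\<rho>\<close> with carrier \<open>\<sigma>\<close>,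
  and such a piece is nonempty exactly if \<open>\<tau> \<subseteq> \<rho>\<close>. Applying \<open>conv_euler_relation\<close> to this
  partition gives the claim up to a common sign, as a face has one vertex more than its dimension.\<close>

theorem open_star_euler:
  assumes \<sigma>: "\<sigma> \<in> \<Delta>" and \<tau>: "\<tau> \<in> \<Delta>'" and sub: "carrier_face \<tau> \<subseteq> \<sigma>"
  shows "(\<Sum>\<rho> | \<rho> \<in> \<Delta>' \<and> carrier_face \<rho> = \<sigma> \<and> \<tau> \<subseteq> \<rho>. (-1) ^ card \<rho>) = ((-1) ^ card \<sigma> :: real)"
proof (cases "\<sigma> = {}")
  case True
  have empty: "\<rho> = {}" if "\<rho> \<in> \<Delta>'" "carrier_face \<rho> = {}" for \<rho>
    using card_le_carrier[OF that(1)] that fine.finite_face by simp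
  then have "{\<rho>. \<rho> \<in> \<Delta>' \<and> carrier_face \<rho> = \<sigma> \<and> \<tau> \<subseteq> \<rho>} = {{}}"
    using True empty[OF \<tau>] sub carrier_empty fine.empty_face by auto
  then show ?thesis using True by simp
next
  case False
  obtain U where U: "open U" "convex U" "rel_interior (face_body \<phi> \<sigma>) \<inter> U \<noteq> {}"
    "\<And>\<rho>. \<rho> \<in> \<Delta>' \<Longrightarrow> \<rho> \<noteq> {} \<Longrightarrow> rel_interior (face_body \<psi> \<rho>) \<inter> U \<noteq> {} \<longleftrightarrow> \<tau> \<subseteq> \<rho>"
    using star_neighbourhood[OF \<sigma> \<tau> sub False] by blast
  let ?R = "{\<rho> \<in> \<Delta>'. carrier_face \<rho> = \<sigma>}"
  define S where "S = rel_interior (face_body \<phi> \<sigma>) \<inter> U"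
  define C where "C = (\<lambda>\<rho>. rel_interior (face_body \<psi> \<rho>) \<inter> U)"
  have finR: "finite ?R" using fine.finite_complex by simp
  have nonempty: "\<rho> \<noteq> {}" if "\<rho> \<in> ?R" for \<rho>
    using that False carrier_empty by auto
  have euler_S: "conv_euler S = - ((-1) ^ card \<sigma>)"
  proof -
    have "card \<sigma> > 0" using False coarse.finite_face[OF \<sigma>] by (simp add: card_gt_0_iff)
    then obtain m where m: "card \<sigma> = Suc m" using gr0_implies_Suc by blast
    have "conv_euler S = (-1) ^ nat (aff_dim (rel_interior (face_body \<phi> \<sigma>)))"
      unfolding S_def using U coarse.convex_face_body by (intro conv_euler_Int_open convex_rel_interior)
    then show ?thesis
      by (simp add: rel_interior_aff_dim coarse.convex_face_body coarse.aff_dim_face_body[OF \<sigma>] m)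
  qed
  have euler_C: "conv_euler (C \<rho>) = (if \<tau> \<subseteq> \<rho> then - ((-1) ^ card \<rho>) else 0)" if \<rho>: "\<rho> \<in> ?R" for \<rho>
  proof (cases "\<tau> \<subseteq> \<rho>")
    case True
    have "card \<rho> > 0" using nonempty[OF \<rho>] \<rho> fine.finite_face by (simp add: card_gt_0_iff)
    then obtain m where m: "card \<rho> = Suc m" using gr0_implies_Suc by blast
    have "conv_euler (C \<rho>) = (-1) ^ nat (aff_dim (rel_interior (face_body \<psi> \<rho>)))"
      unfolding C_def using U True nonempty[OF \<rho>] \<rho> fine.convex_face_body
      by (intro conv_euler_Int_open convex_rel_interior) auto
    moreover have "aff_dim (face_body \<psi> \<rho>) = int m"
      using \<rho> fine.aff_dim_face_body[of \<rho>] m by simp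
    ultimately show ?thesis using True
      by (simp add: rel_interior_aff_dim fine.convex_face_body m)
  next
    case False
    then have "C \<rho> = {}" using U(4) nonempty[OF \<rho>] \<rho> unfolding C_def by blast
    then show ?thesis using False by (simp add: conv_euler_def)
  qed
  have partition: "(\<Sum>\<rho>\<in>?R. indicator (C \<rho>) x) = (indicator S x :: real)" for x
  proof (cases "x \<in> S")
    case True
    then have xS: "x \<in> rel_interior (face_body \<phi> \<sigma>)" and xU: "x \<in> U"
      unfolding S_def by simp_all
    obtain \<rho> where "\<rho> \<in> \<Delta>'" "carrier_face \<rho> = \<sigma>" "x \<in> rel_interior (face_body \<psi> \<rho>)"
      using rel_interior_partition[OF \<sigma> xS] by (elim bexE conjE)
    then have \<rho>: "\<rho> \<in> ?R" "x \<in> C \<rho>" using xU unfolding C_def by simp_all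
    have "x \<in> C \<rho>' \<longleftrightarrow> \<rho>' = \<rho>" if "\<rho>' \<in> ?R" for \<rho>'
    proof
      assume "x \<in> C \<rho>'"
      then show "\<rho>' = \<rho>"
        using fine.open_faces_disjoint[of \<rho>' \<rho> x] \<rho> that unfolding C_def by simp
    qed (use \<rho>(2) in simp)
    then have "(\<Sum>\<rho>\<in>?R. indicator (C \<rho>) x) = (\<Sum>\<rho>'\<in>?R. if \<rho>' = \<rho> then 1 else (0::real))"
      by (intro sum.cong refl) (simp add: indicator_def)
    then show ?thesis using \<rho>(1) finR True by simp
  next
    case False
    have "x \<notin> C \<rho>" if "\<rho> \<in> ?R" for \<rho>
    proof -
      have "rel_interior (face_body \<psi> \<rho>) \<subseteq> rel_interior (face_body \<phi> \<sigma>)"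
        using that rel_interior_carrier[of \<rho>] by simp
      then show ?thesis using False unfolding S_def C_def by blast
    qed
    then show ?thesis using False by (simp add: indicator_def)
  qed
  \<comment> \<open>\<open>None\<close> indexes the set that is partitioned, with coefficient \<open>1\<close>; the pieces have coefficient \<open>-1\<close>.\<close>
  let ?K = "insert None (Some ` ?R)"
  let ?C = "case_option S C"
  let ?c = "case_option 1 (\<lambda>_. - 1) :: 'b set option \<Rightarrow> real"
  have split: "(\<Sum>k\<in>?K. g k) = g None + (\<Sum>\<rho>\<in>?R. g (Some \<rho>))" for g :: "'b set option \<Rightarrow> real"
    using finR by (simp add: sum.reindex)
  have "(\<Sum>k\<in>?K. ?c k * conv_euler (?C k)) = 0"
  proof (rule conv_euler_relation)
    show "finite ?K" using finR by simp
    show "convex (?C k) \<and> rel_open (?C k) \<and> bounded (?C k)" if "k \<in> ?K" for k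
    proof -
      have cell: "convex (rel_interior B \<inter> U) \<and> rel_open (rel_interior B \<inter> U) \<and> bounded (rel_interior B \<inter> U)"
        if "convex B" "compact B" for B
      proof (intro conjI)
        show "convex (rel_interior B \<inter> U)"
          using that(1) U(2) by (intro convex_Int convex_rel_interior)
        show "rel_open (rel_interior B \<inter> U)"
          using that(1) U(1) by (intro rel_open_Int_open rel_interior_rel_open convex_rel_interior)
        show "bounded (rel_interior B \<inter> U)"
          using rel_interior_subset[of B] by (intro bounded_subset[OF compact_imp_bounded[OF that(2)]]) blast
      qed
      show ?thesis
      proof (cases k)
        case None
        then show ?thesis
          using cell[OF coarse.convex_face_body coarse.compact_face_body[OF \<sigma>]] by (simp add: S_def)
      next
        case (Some \<rho>)
        then have "\<rho> \<in> \<Delta>'" using that by auto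
        with Some show ?thesis
          using cell[OF fine.convex_face_body fine.compact_face_body[of \<rho>]] by (simp add: C_def)
      qed
    qed
    show "(\<Sum>k\<in>?K. ?c k * indicator (?C k) x) = 0" for x
      unfolding split using partition[of x] by (simp only: option.case sum_negf mult_minus1 mult_1)
  qed
  then have "conv_euler S = (\<Sum>\<rho>\<in>?R. conv_euler (C \<rho>))"
    unfolding split by (simp add: sum_negf)
  also have "\<dots> = (\<Sum>\<rho>\<in>?R. if \<tau> \<subseteq> \<rho> then - ((-1) ^ card \<rho>) else 0)"
    by (intro sum.cong refl euler_C)
  also have "\<dots> = (\<Sum>\<rho> | \<rho> \<in> \<Delta>' \<and> carrier_face \<rho> = \<sigma> \<and> \<tau> \<subseteq> \<rho>. - ((-1) ^ card \<rho>))"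
    using finR by (subst sum.inter_filter[symmetric]) (auto intro!: sum.cong)
  finally show ?thesis by (simp add: euler_S sum_negf)
qed

end

section \<open>Polynomials, f-vectors and reversal of h-vectors\<close>

text \<open>Passing from f to h and back substitutes \<open>x - 1\<close> and \<open>x + 1\<close> into a polynomial. Only the entries
  up to \<open>d\<close> survive the encoding as a polynomial, hence the bounds in the lemmas below.\<close>

lemma coeff_vec_poly: "i \<le> d \<Longrightarrow> coeff (vec_poly d v) (d - i) = v i"
proof -
  assume i: "i \<le> d"
  have "coeff (vec_poly d v) (d - i) = (\<Sum>k\<le>d. if k = i then v k else 0)"
    unfolding vec_poly_def coeff_sum coeff_monom
    by (intro sum.cong) (use i in auto)
  then show ?thesis using i by simp
qed

lemma degree_vec_poly_le: "degree (vec_poly d v) \<le> d"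
  unfolding vec_poly_def by (intro degree_sum_le) (auto intro: order_trans[OF degree_monom_le])

lemma vec_poly_coeff:
  assumes "degree p \<le> d"
  shows "vec_poly d (\<lambda>i. coeff p (d - i)) = p"
proof (rule poly_eqI)
  fix n
  show "coeff (vec_poly d (\<lambda>i. coeff p (d - i))) n = coeff p n"
  proof (cases "n \<le> d")
    case True
    then have "coeff (vec_poly d (\<lambda>i. coeff p (d - i))) (d - (d - n)) = coeff p (d - (d - n))"
      by (intro coeff_vec_poly) simp
    then show ?thesis using True by simp
  next
    case False
    then show ?thesis
      using assms degree_vec_poly_le[of d "\<lambda>i. coeff p (d - i)"] by (simp add: coeff_eq_0)
  qed
qed

lemma vec_poly_cong: "(\<And>i. i \<le> d \<Longrightarrow> v i = w i) \<Longrightarrow> vec_poly d v = vec_poly d w"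
  unfolding vec_poly_def by (intro sum.cong) auto

lemma vec_poly_shift:
  "vec_poly d (\<lambda>i. coeff (pcompose (vec_poly d v) [:a, 1:]) (d - i)) = pcompose (vec_poly d v) [:a, 1:]"
  using degree_vec_poly_le[of d v] by (intro vec_poly_coeff) (simp add: degree_pcompose)

lemma h_to_f_f_to_h: "i \<le> d \<Longrightarrow> h_to_f d (f_to_h d f) i = f i"
  unfolding h_to_f_def f_to_h_def vec_poly_shift
  by (simp add: pcompose_assoc[symmetric] pcompose_pCons coeff_vec_poly pcompose_idR)

lemma f_to_h_h_to_f: "i \<le> d \<Longrightarrow> f_to_h d (h_to_f d h) i = h i"
  unfolding h_to_f_def f_to_h_def vec_poly_shift
  by (simp add: pcompose_assoc[symmetric] pcompose_pCons coeff_vec_poly pcompose_idR)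

lemma f_to_h_cong: "(\<And>i. i \<le> d \<Longrightarrow> v i = w i) \<Longrightarrow> f_to_h d v = f_to_h d w"
  unfolding f_to_h_def using vec_poly_cong[of d v w] by simp

lemma h_to_f_cong: "(\<And>i. i \<le> d \<Longrightarrow> v i = w i) \<Longrightarrow> h_to_f d v = h_to_f d w"
  unfolding h_to_f_def using vec_poly_cong[of d v w] by simp

lemma vec_poly_sum: "vec_poly d (\<lambda>i. \<Sum>j\<in>A. c j * v j i) = (\<Sum>j\<in>A. Polynomial.smult (c j) (vec_poly d (v j)))"
proof -
  have "coeff (vec_poly d (\<lambda>i. \<Sum>j\<in>A. c j * v j i)) n = coeff (\<Sum>j\<in>A. Polynomial.smult (c j) (vec_poly d (v j))) n" for n
  proof -
    have "coeff (vec_poly d (\<lambda>i. \<Sum>j\<in>A. c j * v j i)) n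
        = (\<Sum>i\<le>d. \<Sum>j\<in>A. c j * coeff (monom (v j i) (d - i)) n)"
      unfolding vec_poly_def coeff_sum by (intro sum.cong) auto
    also have "\<dots> = (\<Sum>j\<in>A. \<Sum>i\<le>d. c j * coeff (monom (v j i) (d - i)) n)"
      by (rule sum.swap)
    finally show ?thesis by (simp add: vec_poly_def coeff_sum sum_distrib_left)
  qed
  then show ?thesis by (intro poly_eqI)
qed

lemma f_to_h_sum: "f_to_h d (\<lambda>i. \<Sum>j\<in>A. c j * v j i) i = (\<Sum>j\<in>A. c j * f_to_h d (v j) i)"
  unfolding f_to_h_def vec_poly_sum by (simp add: pcompose_sum pcompose_smult coeff_sum)

lemma coeff_one_plus_x_power: "coeff ([:1, 1:] ^ m) k = real (m choose k)"
proof (cases "k \<le> m")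
  case True
  then show ?thesis by (simp add: coeff_linear_poly_power)
next
  case False
  then have "degree ([:1, 1::real:] ^ m) < k" by (simp add: degree_power_eq)
  then show ?thesis using False by (simp add: coeff_eq_0)
qed

lemma h_to_f_explicit: "n \<le> d \<Longrightarrow> h_to_f d h n = (\<Sum>i\<le>d. h i * real ((d - i) choose (d - n)))"
proof -
  assume n: "n \<le> d"
  have "pcompose (monom c m) [:1, 1:] = Polynomial.smult c ([:1, 1:] ^ m)" for c :: real and m
    by (induction m) (simp_all add: monom_Suc pcompose_pCons monom_0 mult.commute)
  then show ?thesis
    unfolding h_to_f_def vec_poly_def pcompose_sum coeff_sum
    by (simp add: coeff_one_plus_x_power)
qed

lemma h_to_f_sum: "h_to_f d (\<lambda>i. \<Sum>j\<in>A. c j * v j i) i = (\<Sum>j\<in>A. c j * h_to_f d (v j) i)"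
  unfolding h_to_f_def vec_poly_sum by (simp add: pcompose_sum pcompose_smult coeff_sum)

lemma f_to_h_0: "f_to_h d f 0 = f 0"
proof -
  have "h_to_f d (f_to_h d f) 0 = f_to_h d f 0"
    by (subst h_to_f_explicit) (simp_all add: binomial_eq_0 sum.atMost_shift)
  then show ?thesis by (simp add: h_to_f_f_to_h)
qed

lemma h_to_f_0: "h_to_f d h 0 = h 0"
  using f_to_h_0[of d "h_to_f d h"] by (simp add: f_to_h_h_to_f)

text \<open>Reversing an h-vector replaces \<open>h(x)\<close> by \<open>x\<^sup>d h(1/x)\<close>, which for the f-polynomial means
  \<open>(x + 1)\<^sup>d f(- x / (x + 1))\<close>. This is the resulting operation on the coefficients of \<open>f\<close>.\<close>

definition euler_dual :: "nat \<Rightarrow> (nat \<Rightarrow> real) \<Rightarrow> nat \<Rightarrow> real" where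
  "euler_dual d f n = (\<Sum>j\<le>d. (-1) ^ (d - j) * real (j choose n) * f j)"

text \<open>Compare coefficients in \<open>(1 + x)\<^sup>i = (1 + x)\<^sup>i (- x + (1 + x))\<^bsup>d - i\<^esup>\<close>, with the second
  factor expanded by the binomial theorem.\<close>

lemma alternating_binomial_convolution:
  assumes i: "i \<le> d" and n: "n \<le> d"
  shows "(\<Sum>j\<le>d. (-1) ^ (d - j) * real (j choose n) * real ((d - i) choose (d - j)))
       = real (i choose (d - n))"
proof -
  define q :: "real poly" where "q = [:1, 1:]"
  define y :: "real poly" where "y = [:0, -1:]"
  have y: "y ^ m = monom ((-1) ^ m) m" for m
  proof -
    have "y = monom (-1) 1" by (simp add: y_def monom_altdef)
    then show ?thesis by (simp add: monom_power)
  qed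
  have one: "y + q = 1" by (simp add: y_def q_def)
  have "q ^ i = q ^ i * (y + q) ^ (d - i)" by (simp add: one)
  also have "\<dots> = (\<Sum>m\<le>d - i. of_nat ((d - i) choose m) * y ^ m * q ^ (d - m))"
    unfolding binomial_ring sum_distrib_left
  proof (intro sum.cong refl)
    fix m assume "m \<in> {..d - i}"
    then have "q ^ (d - m) = q ^ i * q ^ (d - i - m)" using i by (simp flip: power_add)
    then show "q ^ i * (of_nat (d - i choose m) * y ^ m * q ^ (d - i - m)) =
         of_nat (d - i choose m) * y ^ m * q ^ (d - m)" by (simp add: mult_ac)
  qed
  also have "\<dots> = (\<Sum>m\<le>d. of_nat ((d - i) choose m) * y ^ m * q ^ (d - m))"
    by (intro sum.mono_neutral_left) (auto simp: binomial_eq_0)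
  also have "\<dots> = (\<Sum>j\<le>d. of_nat ((d - i) choose (d - j)) * y ^ (d - j) * q ^ j)"
    by (rule sum.reindex_bij_witness[of _ "\<lambda>j. d - j" "\<lambda>j. d - j"]) auto
  finally have "coeff (q ^ i) (d - n) =
    (\<Sum>j\<le>d. coeff (of_nat ((d - i) choose (d - j)) * y ^ (d - j) * q ^ j) (d - n))"
    by (simp add: coeff_sum)
  also have "\<dots> = (\<Sum>j\<le>d. (-1) ^ (d - j) * real (j choose n) * real ((d - i) choose (d - j)))"
  proof (intro sum.cong refl)
    fix j assume j: "j \<in> {..d}"
    have "coeff (monom ((-1) ^ (d - j)) (d - j) * q ^ j) (d - n) = (-1) ^ (d - j) * real (j choose n)"
    proof (cases "n \<le> j")
      case True
      then have "d - n = (d - j) + (j - n)" using j by auto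
      then show ?thesis using True
        by (simp only: coeff_monom_mult coeff_one_plus_x_power q_def) (simp add: binomial_symmetric[of n j] coeff_monom_mult)
    next
      case False
      then show ?thesis using j n by (simp add: coeff_monom_mult binomial_eq_0)
    qed
    then show "coeff (of_nat ((d - i) choose (d - j)) * y ^ (d - j) * q ^ j) (d - n) =
        (-1) ^ (d - j) * real (j choose n) * real ((d - i) choose (d - j))"
      by (simp add: y of_nat_poly mult.assoc)
  qed
  finally show ?thesis by (simp add: q_def coeff_one_plus_x_power)
qed

lemma h_to_f_reverse:
  assumes "n \<le> d"
  shows "h_to_f d (\<lambda>i. h (d - i)) n = euler_dual d (h_to_f d h) n"
proof -
  have "h_to_f d (\<lambda>i. h (d - i)) n = (\<Sum>i\<le>d. h i * real (i choose (d - n)))"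
    unfolding h_to_f_explicit[OF assms]
    by (rule sum.reindex_bij_witness[of _ "\<lambda>j. d - j" "\<lambda>j. d - j"]) auto
  also have "\<dots> = (\<Sum>i\<le>d. \<Sum>j\<le>d. h i *
      ((-1) ^ (d - j) * real (j choose n) * real ((d - i) choose (d - j))))"
    using alternating_binomial_convolution[OF _ assms]
    by (intro sum.cong) (simp_all flip: sum_distrib_left)
  also have "\<dots> = (\<Sum>j\<le>d. (-1) ^ (d - j) * real (j choose n) *
      (\<Sum>i\<le>d. h i * real ((d - i) choose (d - j))))"
    unfolding sum_distrib_left by (subst sum.swap) (simp add: mult_ac)
  also have "\<dots> = euler_dual d (h_to_f d h) n"
    unfolding euler_dual_def by (intro sum.cong) (simp_all add: h_to_f_explicit)
  finally show ?thesis .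
qed

section \<open>The linear map on f-vectors\<close>

lemma sum_Pow_card:
  fixes g :: "nat \<Rightarrow> real"
  assumes "finite S"
  shows "(\<Sum>T\<in>Pow S. g (card T)) = (\<Sum>t\<le>card S. real (card S choose t) * g t)"
proof -
  have "(\<Sum>T\<in>Pow S. g (card T)) = (\<Sum>t\<le>card S. \<Sum>T | T \<in> Pow S \<and> card T = t. g (card T))"
    using assms by (intro sum.group[symmetric]) (auto intro: card_mono)
  also have "\<dots> = (\<Sum>t\<le>card S. real (card S choose t) * g t)"
    by (intro sum.cong refl) (simp add: n_subsets[OF assms])
  finally show ?thesis .
qed

text \<open>The matrix of \<^const>\<open>f_transform\<close> indexed by numbers of vertices instead of dimensions, so that
  the empty face is included. By \<open>open_count_eq\<close> below, the entry is the number of faces with \<open>n\<close>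
  vertices whose carrier is a given face with \<open>j\<close> vertices.\<close>

definition open_face_coeff :: "(nat \<Rightarrow> nat \<Rightarrow> nat) \<Rightarrow> nat \<Rightarrow> nat \<Rightarrow> real" where
  "open_face_coeff F n j = (case n of 0 \<Rightarrow> if j = 0 then 1 else 0
     | Suc i \<Rightarrow> if j = 0 then 0 else g_coeff F i (j - 1))"

lemma open_face_coeff_triangular: "j < n \<Longrightarrow> open_face_coeff F n j = 0"
  by (cases n) (auto simp: open_face_coeff_def g_coeff_def)

lemma f_transform_altdef: "f_transform d F f n = (\<Sum>j\<le>d. open_face_coeff F n j * f j)"
proof (cases n)
  case 0
  then show ?thesis by (simp add: f_transform_def open_face_coeff_def if_distrib[of "\<lambda>x. x * _"] cong: if_cong)
next
  case (Suc i)
  have "(\<Sum>j\<le>d. open_face_coeff F n j * f j) = (\<Sum>j<d. open_face_coeff F n (Suc j) * f (Suc j))"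
    by (subst sum.atMost_shift) (simp add: open_face_coeff_def Suc)
  also have "\<dots> = (\<Sum>j=i..<d. open_face_coeff F n (Suc j) * f (Suc j))"
    by (rule sum.mono_neutral_right) (auto simp: open_face_coeff_triangular Suc)
  finally show ?thesis by (simp add: f_transform_def open_face_coeff_def Suc)
qed

lemma f_transform_cong: "(\<And>i. i \<le> d \<Longrightarrow> f i = g i) \<Longrightarrow> f_transform d F f = f_transform d F g"
  by (rule ext) (simp add: f_transform_altdef)

lemma f_transform_sum:
  "f_transform d F (\<lambda>i. \<Sum>j\<in>A. c j * v j i) n = (\<Sum>j\<in>A. c j * f_transform d F (v j) n)"
  unfolding f_transform_altdef sum_distrib_left
  by (subst sum.swap) (simp add: mult_ac)

lemma f_transform_0: "f_transform d F f 0 = f 0"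
  by (simp add: f_transform_def)

text \<open>Solve the triangular system from the last equation upwards; \<open>m\<close> counts the equations solved.\<close>

lemma f_transform_surj:
  assumes "\<And>j. j \<le> d \<Longrightarrow> open_face_coeff F j j \<noteq> 0"
  shows "\<exists>f. \<forall>n\<le>d. f_transform d F f n = g n"
proof -
  have "\<exists>f. \<forall>n\<le>d. d < n + m \<longrightarrow> f_transform d F f n = g n" if "m \<le> Suc d" for m
    using that
  proof (induction m)
    case 0
    then show ?case by auto
  next
    case (Suc m)
    then obtain f where f: "\<And>n. n \<le> d \<Longrightarrow> d < n + m \<Longrightarrow> f_transform d F f n = g n" by auto
    define k where "k = d - m"
    have k: "k \<le> d" "d < n + m \<longleftrightarrow> k < n" "d < n + Suc m \<longleftrightarrow> k \<le> n" for n
      using Suc.prems by (auto simp: k_def)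
    define c where "c = (g k - f_transform d F f k) / open_face_coeff F k k"
    define f' where "f' = f(k := f k + c)"
    have upd: "f_transform d F f' n = f_transform d F f n + open_face_coeff F n k * c" for n
    proof -
      have "f_transform d F f' n =
        (\<Sum>j\<le>d. open_face_coeff F n j * f j + (if j = k then open_face_coeff F n k * c else 0))"
        unfolding f_transform_altdef by (intro sum.cong) (auto simp: f'_def algebra_simps)
      then show ?thesis using k(1) by (simp add: sum.distrib f_transform_altdef)
    qed
    have "f_transform d F f' n = g n" if n: "n \<le> d" "d < n + Suc m" for n
    proof (cases "n = k")
      case True
      then show ?thesis using assms[OF k(1)] by (simp add: upd c_def)
    next
      case False
      then have "k < n" using n(2) unfolding k(3) by simp
      then show ?thesis using f[OF n(1)] k(2) by (simp add: upd open_face_coeff_triangular)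
    qed
    then show ?case by blast
  qed
  from this[of "Suc d"] show ?thesis by auto
qed

section \<open>Counting faces by their carriers\<close>

locale uniform_subdivision = geometric_subdivision \<Delta> \<phi> \<Delta>' \<psi>
  for \<Delta> :: "'a set set" and \<phi> :: "'a \<Rightarrow> 'e::euclidean_space"
    and \<Delta>' :: "'b set set" and \<psi> :: "'b \<Rightarrow> 'e" +
  fixes F :: "nat \<Rightarrow> nat \<Rightarrow> nat" and d :: nat
  assumes uniform: "\<sigma> \<in> \<Delta> \<Longrightarrow> face_dim \<sigma> = int j \<Longrightarrow> i \<le> j \<Longrightarrow>
      F i j = card {\<tau> \<in> \<Delta>'. face_body \<psi> \<tau> \<subseteq> face_body \<phi> \<sigma> \<and> face_dim \<tau> = int i}"
    and dim: "complex_dim \<Delta> = int d - 1"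
begin

lemma card_le_dim:
  assumes "\<sigma> \<in> \<Delta>"
  shows "card \<sigma> \<le> d"
proof -
  have "face_dim \<sigma> \<le> complex_dim \<Delta>"
    unfolding complex_dim_def using assms coarse.finite_complex by (intro Max_ge) simp_all
  then show ?thesis by (simp add: dim face_dim_def)
qed

lemma face_of_card_exists:
  assumes "j \<le> d"
  shows "\<exists>\<sigma>\<in>\<Delta>. card \<sigma> = j"
proof -
  have "complex_dim \<Delta> \<in> face_dim ` \<Delta>"
    unfolding complex_dim_def using coarse.finite_complex coarse.empty_face by (intro Max_in) auto
  then obtain \<sigma> where \<sigma>: "\<sigma> \<in> \<Delta>" "card \<sigma> = d"
    using dim by (auto simp: face_dim_def)
  from assms \<sigma>(2) obtain \<tau> where "\<tau> \<subseteq> \<sigma>" "card \<tau> = j"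
    by (metis obtain_subset_with_card_n)
  then show ?thesis using coarse.subface[OF \<sigma>(1)] by blast
qed

lemma complex_dim_subdivision: "complex_dim \<Delta>' = int d - 1"
proof -
  obtain \<sigma> where \<sigma>: "\<sigma> \<in> \<Delta>" "card \<sigma> = d" using face_of_card_exists by blast
  obtain \<rho> where \<rho>: "\<rho> \<in> \<Delta>'" "card \<rho> = d" using carrier_full_dim_exists[OF \<sigma>(1)] \<sigma>(2) by blast
  have le: "face_dim \<tau> \<le> int d - 1" if "\<tau> \<in> \<Delta>'" for \<tau>
    using card_le_carrier[OF that] card_le_dim[OF carrier_in[OF that]] by (simp add: face_dim_def)
  have "int d - 1 \<in> face_dim ` \<Delta>'"
    using \<rho> by (intro image_eqI[of _ _ \<rho>]) (simp_all add: face_dim_def)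
  then show ?thesis
    unfolding complex_dim_def using fine.finite_complex le by (intro Max_eqI) auto
qed

definition open_count :: "nat \<Rightarrow> 'a set \<Rightarrow> nat" where
  "open_count n \<sigma> = card {\<rho> \<in> \<Delta>'. carrier_face \<rho> = \<sigma> \<and> card \<rho> = n}"

lemma closed_count:
  assumes \<sigma>: "\<sigma> \<in> \<Delta>"
  shows "real (card {\<rho> \<in> \<Delta>'. carrier_face \<rho> \<subseteq> \<sigma> \<and> card \<rho> = n}) = (\<Sum>\<kappa>\<in>Pow \<sigma>. real (open_count n \<kappa>))"
proof -
  have "(\<Sum>\<kappa>\<in>Pow \<sigma>. \<Sum>\<rho> | \<rho> \<in> {\<rho> \<in> \<Delta>'. carrier_face \<rho> \<subseteq> \<sigma> \<and> card \<rho> = n} \<and> carrier_face \<rho> = \<kappa>. 1::real)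
      = (\<Sum>\<rho>\<in>{\<rho> \<in> \<Delta>'. carrier_face \<rho> \<subseteq> \<sigma> \<and> card \<rho> = n}. 1)"
    using fine.finite_complex coarse.finite_face[OF \<sigma>] by (intro sum.group) auto
  moreover have "{\<rho> \<in> {\<rho> \<in> \<Delta>'. carrier_face \<rho> \<subseteq> \<sigma> \<and> card \<rho> = n}. carrier_face \<rho> = \<kappa>}
      = {\<rho> \<in> \<Delta>'. carrier_face \<rho> = \<kappa> \<and> card \<rho> = n}" if "\<kappa> \<in> Pow \<sigma>" for \<kappa>
    using that by auto
  ultimately show ?thesis by (simp add: open_count_def)
qed

lemma closed_count_F:
  assumes \<sigma>: "\<sigma> \<in> \<Delta>" and n: "card \<sigma> = Suc j" "i \<le> j"
  shows "card {\<rho> \<in> \<Delta>'. carrier_face \<rho> \<subseteq> \<sigma> \<and> card \<rho> = Suc i} = F i j"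
proof -
  have "{\<rho> \<in> \<Delta>'. carrier_face \<rho> \<subseteq> \<sigma> \<and> card \<rho> = Suc i}
      = {\<tau> \<in> \<Delta>'. face_body \<psi> \<tau> \<subseteq> face_body \<phi> \<sigma> \<and> face_dim \<tau> = int i}"
    using carrier_subset_iff[OF _ \<sigma>] by (auto simp: face_dim_def)
  then show ?thesis using uniform[OF \<sigma>, of j i] n by (simp add: face_dim_def)
qed

text \<open>The array \<open>F\<close> counts the fine faces inside a closed face, that is, the sum of the open counts over
  all its faces. Moebius inversion over the Boolean lattice of these faces recovers the open count, and
  as \<open>F\<close> only depends on the number of vertices, the result is the formula in \<^const>\<open>g_coeff\<close>.\<close>

lemma open_count_eq:
  assumes \<sigma>: "\<sigma> \<in> \<Delta>"
  shows "real (open_count n \<sigma>) = open_face_coeff F n (card \<sigma>)"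
proof (cases n)
  case 0
  have "{\<rho> \<in> \<Delta>'. carrier_face \<rho> = \<sigma> \<and> card \<rho> = 0} = (if \<sigma> = {} then {{}} else {})"
    using fine.finite_face fine.empty_face carrier_empty by auto
  then show ?thesis
    using 0 coarse.finite_face[OF \<sigma>] by (simp add: open_count_def open_face_coeff_def)
next
  case (Suc i)
  \<comment> \<open>The number of fine faces with \<open>Suc i\<close> vertices in a closed face with \<open>t\<close> vertices.\<close>
  define g where "g t = (if t \<le> i then 0 else real (F i (t - 1)))" for t
  have g: "(\<Sum>\<kappa>\<in>Pow T. real (open_count n \<kappa>)) = g (card T)" if T: "T \<in> Pow \<sigma>" for T
  proof -
    have T': "T \<in> \<Delta>" using coarse.subface[OF \<sigma>] T by blast
    show ?thesis
    proof (cases "card T \<le> i")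
      case True
      have "card \<rho> \<le> i" if "\<rho> \<in> \<Delta>'" "carrier_face \<rho> \<subseteq> T" for \<rho>
        using card_le_carrier[OF that(1)] card_mono[OF coarse.finite_face[OF T'] that(2)] True by simp
      then have empty: "{\<rho> \<in> \<Delta>'. carrier_face \<rho> \<subseteq> T \<and> card \<rho> = n} = {}" using Suc by fastforce
      show ?thesis
        unfolding closed_count[OF T', of n, symmetric] empty using True by (simp add: g_def)
    next
      case False
      then obtain j where j: "card T = Suc j" "i \<le> j" by (cases "card T") auto
      then show ?thesis
        using closed_count[OF T', of n] closed_count_F[OF T' j] Suc by (simp add: g_def)
    qed
  qed
  have "real (open_count n \<sigma>)
      = (\<Sum>T\<in>Pow \<sigma>. (-1) ^ (card \<sigma> - card T) * (\<Sum>\<kappa>\<in>Pow T. real (open_count n \<kappa>)))"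
    by (rule inclusion_exclusion_mobius) (simp_all add: coarse.finite_face[OF \<sigma>])
  also have "\<dots> = (\<Sum>T\<in>Pow \<sigma>. (-1) ^ (card \<sigma> - card T) * g (card T))"
    by (intro sum.cong refl) (simp only: g)
  also have "\<dots> = (\<Sum>t\<le>card \<sigma>. real (card \<sigma> choose t) * ((-1) ^ (card \<sigma> - t) * g t))"
    by (rule sum_Pow_card[OF coarse.finite_face[OF \<sigma>]])
  also have "\<dots> = open_face_coeff F n (card \<sigma>)"
  proof (cases "card \<sigma>")
    case 0
    then show ?thesis by (simp add: g_def open_face_coeff_def Suc)
  next
    case (Suc j)
    have "(\<Sum>t\<le>card \<sigma>. real (card \<sigma> choose t) * ((-1) ^ (card \<sigma> - t) * g t))
        = (\<Sum>k\<le>j. real (Suc j choose Suc k) * ((-1) ^ (j - k) * g (Suc k)))"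
      unfolding Suc sum.atMost_Suc_shift by (simp add: g_def)
    also have "\<dots> = (\<Sum>k=i..j. real (Suc j choose Suc k) * ((-1) ^ (j - k) * g (Suc k)))"
      by (rule sum.mono_neutral_right) (auto simp: g_def)
    also have "\<dots> = g_coeff F i j"
      unfolding g_coeff_def by (intro sum.cong) (auto simp: g_def)
    finally show ?thesis using Suc \<open>n = Suc i\<close> by (simp add: open_face_coeff_def)
  qed
  finally show ?thesis .
qed

lemma open_face_coeff_diag:
  assumes "j \<le> d"
  shows "open_face_coeff F j j \<noteq> 0"
proof -
  obtain \<sigma> where \<sigma>: "\<sigma> \<in> \<Delta>" "card \<sigma> = j" using face_of_card_exists[OF assms] by blast
  obtain \<rho> where "\<rho> \<in> \<Delta>'" "carrier_face \<rho> = \<sigma>" "card \<rho> = j"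
    using carrier_full_dim_exists[OF \<sigma>(1)] \<sigma>(2) by blast
  then have "{\<rho> \<in> \<Delta>'. carrier_face \<rho> = \<sigma> \<and> card \<rho> = j} \<noteq> {}" by blast
  then have "open_count j \<sigma> \<noteq> 0"
    unfolding open_count_def using fine.finite_complex by simp
  then show ?thesis using open_count_eq[OF \<sigma>(1), of j] \<sigma>(2) by simp
qed

lemma f_vector_card: "f_vector \<Gamma> n = real (card {\<sigma> \<in> \<Gamma>. card \<sigma> = n})"
proof -
  have "{\<sigma> \<in> \<Gamma>. face_dim \<sigma> = int n - 1} = {\<sigma> \<in> \<Gamma>. card \<sigma> = n}" by (auto simp: face_dim_def)
  then show ?thesis by (simp add: f_vector_def face_number_def)
qed

text \<open>Sort the fine faces by their carriers.\<close>

lemma f_vector_subdivision: "f_vector \<Delta>' n = f_transform d F (f_vector \<Delta>) n"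
proof -
  have "f_vector \<Delta>' n = (\<Sum>\<rho>\<in>{\<rho> \<in> \<Delta>'. card \<rho> = n}. 1)" by (simp add: f_vector_card)
  also have "\<dots> = (\<Sum>\<sigma>\<in>\<Delta>. \<Sum>\<rho> | \<rho> \<in> {\<rho> \<in> \<Delta>'. card \<rho> = n} \<and> carrier_face \<rho> = \<sigma>. 1)"
    using fine.finite_complex coarse.finite_complex carrier_in
    by (intro sum.group[symmetric]) auto
  also have "\<dots> = (\<Sum>\<sigma>\<in>\<Delta>. real (open_count n \<sigma>))"
    by (intro sum.cong refl) (simp add: open_count_def conj_ac)
  also have "\<dots> = (\<Sum>\<sigma>\<in>\<Delta>. open_face_coeff F n (card \<sigma>))"
    by (intro sum.cong refl open_count_eq)
  also have "\<dots> = (\<Sum>j\<le>d. \<Sum>\<sigma> | \<sigma> \<in> \<Delta> \<and> card \<sigma> = j. open_face_coeff F n (card \<sigma>))"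
    using coarse.finite_complex card_le_dim by (intro sum.group[symmetric]) auto
  also have "\<dots> = (\<Sum>j\<le>d. open_face_coeff F n j * f_vector \<Delta> j)"
    by (intro sum.cong refl) (simp add: f_vector_card)
  finally show ?thesis by (simp add: f_transform_altdef)
qed

text \<open>For a face \<open>\<sigma>\<close> with \<open>j\<close> vertices both sides count pairs \<open>\<tau> \<subseteq> \<rho>\<close>, where \<open>\<tau>\<close> has \<open>n\<close>
  vertices, \<open>\<rho>\<close> has carrier \<open>\<sigma>\<close> and the pair has sign \<open>(-1) ^ card \<rho>\<close>. Summing over \<open>\<tau>\<close> first
  gives the right-hand side. Summing over \<open>\<rho>\<close> first, \<open>open_star_euler\<close> turns every \<open>\<tau>\<close> in the
  closed face into \<open>(-1) ^ j\<close>, and the sum on the left is the number of these \<open>\<tau>\<close>.\<close>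

lemma open_closed_duality:
  assumes "j \<le> d"
  shows "(-1) ^ j * (\<Sum>k\<le>d. open_face_coeff F n k * real (j choose k))
       = (\<Sum>k\<le>d. (-1) ^ k * real (k choose n) * open_face_coeff F k j)"
proof -
  obtain \<sigma> where \<sigma>: "\<sigma> \<in> \<Delta>" "card \<sigma> = j" using face_of_card_exists[OF assms] by blast
  let ?T = "{\<tau> \<in> \<Delta>'. carrier_face \<tau> \<subseteq> \<sigma> \<and> card \<tau> = n}"
  let ?R = "{\<rho> \<in> \<Delta>'. carrier_face \<rho> = \<sigma>}"
  have fin: "finite ?T" "finite ?R" using fine.finite_complex by simp_all
  have "(\<Sum>k\<le>d. open_face_coeff F n k * real (j choose k))
      = (\<Sum>k\<le>j. real (j choose k) * open_face_coeff F n k)"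
    using assms by (intro sum.mono_neutral_cong_right) (auto simp: binomial_eq_0)
  also have "\<dots> = (\<Sum>\<kappa>\<in>Pow \<sigma>. open_face_coeff F n (card \<kappa>))"
    using sum_Pow_card[OF coarse.finite_face[OF \<sigma>(1)], of "open_face_coeff F n"] \<sigma>(2) by simp
  also have "\<dots> = (\<Sum>\<kappa>\<in>Pow \<sigma>. real (open_count n \<kappa>))"
    using coarse.subface[OF \<sigma>(1)] by (intro sum.cong refl open_count_eq[symmetric]) auto
  also have "\<dots> = real (card ?T)" by (rule closed_count[OF \<sigma>(1), symmetric])
  finally have "(-1) ^ j * (\<Sum>k\<le>d. open_face_coeff F n k * real (j choose k))
      = (\<Sum>\<tau>\<in>?T. (-1) ^ card \<sigma>)" using \<sigma>(2) by simp
  also have "\<dots> = (\<Sum>\<tau>\<in>?T. \<Sum>\<rho> | \<rho> \<in> ?R \<and> \<tau> \<subseteq> \<rho>. (-1) ^ card \<rho>)"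
    using open_star_euler[OF \<sigma>(1)] by (intro sum.cong refl) (simp add: conj_assoc)
  also have "\<dots> = (\<Sum>\<rho>\<in>?R. \<Sum>\<tau> | \<tau> \<in> ?T \<and> \<tau> \<subseteq> \<rho>. (-1) ^ card \<rho>)"
    using fin by (rule sum.swap_restrict)
  also have "\<dots> = (\<Sum>\<rho>\<in>?R. (-1) ^ card \<rho> * real (card \<rho> choose n))"
  proof (intro sum.cong refl)
    fix \<rho> assume \<rho>: "\<rho> \<in> ?R"
    have "{\<tau>. \<tau> \<in> ?T \<and> \<tau> \<subseteq> \<rho>} = {\<tau>. \<tau> \<subseteq> \<rho> \<and> card \<tau> = n}"
      using \<rho> fine.subface[of \<rho>] carrier_mono[of \<rho>] by auto
    then have "card {\<tau>. \<tau> \<in> ?T \<and> \<tau> \<subseteq> \<rho>} = (card \<rho> choose n)"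
      using n_subsets[of \<rho> n] fine.finite_face \<rho> by simp
    then show "(\<Sum>\<tau> | \<tau> \<in> ?T \<and> \<tau> \<subseteq> \<rho>. (-1) ^ card \<rho>) = (-1) ^ card \<rho> * real (card \<rho> choose n)"
      by simp
  qed
  also have "\<dots> = (\<Sum>k\<le>d. \<Sum>\<rho> | \<rho> \<in> ?R \<and> card \<rho> = k. (-1) ^ card \<rho> * real (card \<rho> choose n))"
    using fin(2) card_le_carrier card_le_dim[OF \<sigma>(1)]
    by (intro sum.group[symmetric]) (auto intro: order_trans)
  also have "\<dots> = (\<Sum>k\<le>d. (-1) ^ k * real (k choose n) * real (open_count k \<sigma>))"
    by (intro sum.cong refl) (simp add: open_count_def conj_assoc)
  also have "\<dots> = (\<Sum>k\<le>d. (-1) ^ k * real (k choose n) * open_face_coeff F k j)"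
    using open_count_eq[OF \<sigma>(1)] \<sigma>(2) by simp
  finally show ?thesis .
qed

lemma f_transform_euler_dual:
  "f_transform d F (euler_dual d f) n = euler_dual d (f_transform d F f) n"
proof -
  have sgn: "(-1) ^ (d - j) = (-1) ^ d * ((-1) ^ j :: real)" if "j \<le> d" for j
    using that by (simp add: neg_one_power_add_eq_neg_one_power_diff flip: power_add)
  have "f_transform d F (euler_dual d f) n =
      (\<Sum>j\<le>d. (-1) ^ d * f j * ((-1) ^ j * (\<Sum>k\<le>d. open_face_coeff F n k * real (j choose k))))"
    unfolding f_transform_altdef euler_dual_def sum_distrib_left
    by (subst sum.swap, intro sum.cong refl) (simp add: sgn)
  also have "\<dots> = (\<Sum>j\<le>d. (-1) ^ d * f j *
      (\<Sum>k\<le>d. (-1) ^ k * real (k choose n) * open_face_coeff F k j))"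
    by (intro sum.cong refl) (simp add: open_closed_duality)
  also have "\<dots> = euler_dual d (f_transform d F f) n"
    unfolding f_transform_altdef euler_dual_def sum_distrib_left
    by (subst sum.swap, intro sum.cong refl) (simp add: sgn)
  finally show ?thesis .
qed

end

section \<open>Total positivity of order two\<close>

text \<open>Cauchy-Binet for a two-row matrix times a two-column matrix: the difference of the two sides is
  the sum over \<open>j < k\<close> of products of corresponding minors. Summing over all pairs \<open>(j, k)\<close> counts
  each product twice and avoids the restriction to \<open>j < k\<close>.\<close>

lemma TP2_pair_preserved:
  fixes u v a b :: "nat \<Rightarrow> real"
  assumes ab: "\<And>j k. j < k \<Longrightarrow> k \<le> d \<Longrightarrow> a k * b j \<le> a j * b k"
    and uv: "\<And>j k. j < k \<Longrightarrow> k \<le> d \<Longrightarrow> u k * v j \<le> u j * v k"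
  shows "(\<Sum>j\<le>d. b j * u j) * (\<Sum>j\<le>d. a j * v j) \<le> (\<Sum>j\<le>d. a j * u j) * (\<Sum>j\<le>d. b j * v j)"
proof -
  have pos: "0 \<le> (a j * b k - a k * b j) * (u j * v k - u k * v j)" if "j \<le> d" "k \<le> d" for j k
  proof (cases j k rule: linorder_cases)
    case less
    then show ?thesis using ab[of j k] uv[of j k] that by simp
  next
    case greater
    then show ?thesis using ab[of k j] uv[of k j] that by (intro mult_nonpos_nonpos) simp_all
  qed simp
  have "0 \<le> (\<Sum>j\<le>d. \<Sum>k\<le>d. (a j * b k - a k * b j) * (u j * v k - u k * v j))"
    using pos by (intro sum_nonneg) auto
  also have "\<dots> = (\<Sum>j\<le>d. \<Sum>k\<le>d. a j * u j * (b k * v k) - b j * u j * (a k * v k)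
                       - a j * v j * (b k * u k) + b j * v j * (a k * u k))"
    by (intro sum.cong refl) (simp add: algebra_simps)
  also have "\<dots> = 2 * ((\<Sum>j\<le>d. a j * u j) * (\<Sum>j\<le>d. b j * v j)
                     - (\<Sum>j\<le>d. b j * u j) * (\<Sum>j\<le>d. a j * v j))"
    by (simp add: sum.distrib sum_subtractf flip: sum_product)
  finally show ?thesis by simp
qed

section \<open>The h-vector transformation\<close>

context uniform_subdivision
begin

definition h_transform :: "(nat \<Rightarrow> real) \<Rightarrow> nat \<Rightarrow> real" where
  "h_transform h = f_to_h d (f_transform d F (h_to_f d h))"

lemma h_vector_subdivision: "h_vector \<Delta>' = h_transform (h_vector \<Delta>)"
proof -
  have "f_transform d F (h_to_f d (f_to_h d (f_vector \<Delta>))) = f_transform d F (f_vector \<Delta>)"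
    by (rule f_transform_cong) (rule h_to_f_f_to_h)
  moreover have "f_vector \<Delta>' = f_transform d F (f_vector \<Delta>)"
    using f_vector_subdivision by blast
  ultimately show ?thesis
    by (simp add: h_vector_def h_transform_def dim complex_dim_subdivision)
qed

lemma h_transform_matrix:
  assumes "i \<le> d"
  shows "h_transform h i = (\<Sum>j\<le>d. H_matrix d F $$ (i, j) * h j)"
proof -
  let ?e = "\<lambda>j k. if k = j then 1 else (0::real)"
  have "h_to_f d h = h_to_f d (\<lambda>i. \<Sum>j\<le>d. h j * ?e j i)"
    by (rule h_to_f_cong) (simp add: if_distrib cong: if_cong)
  also have "\<dots> = (\<lambda>i. \<Sum>j\<le>d. h j * h_to_f d (?e j) i)"
    by (rule ext) (rule h_to_f_sum)
  finally have "f_transform d F (h_to_f d h) = (\<lambda>i. \<Sum>j\<le>d. h j * f_transform d F (h_to_f d (?e j)) i)"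
    by (simp add: f_transform_sum[abs_def])
  then have "h_transform h i = (\<Sum>j\<le>d. h j * f_to_h d (f_transform d F (h_to_f d (?e j))) i)"
    unfolding h_transform_def by (simp add: f_to_h_sum)
  also have "\<dots> = (\<Sum>j\<le>d. H_matrix d F $$ (i, j) * h j)"
    using assms by (intro sum.cong refl) (simp add: H_matrix_def)
  finally show ?thesis .
qed

text \<open>The symmetry \<open>H i j = H (d - i) (d - j)\<close>, in the form that the transformation commutes with the
  reversal of vectors. In terms of f-vectors it is \<open>f_transform_euler_dual\<close>.\<close>

lemma h_transform_reverse:
  assumes "i \<le> d"
  shows "h_transform (\<lambda>j. h (d - j)) i = h_transform h (d - i)"
proof -
  let ?f = "f_transform d F (h_to_f d h)"
  have "f_transform d F (h_to_f d (\<lambda>j. h (d - j))) = f_transform d F (euler_dual d (h_to_f d h))"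
    by (rule f_transform_cong) (rule h_to_f_reverse)
  also have "\<dots> = euler_dual d ?f" using f_transform_euler_dual by blast
  finally have "h_transform (\<lambda>j. h (d - j)) = f_to_h d (euler_dual d ?f)"
    by (simp add: h_transform_def)
  also have "\<dots> = f_to_h d (h_to_f d (\<lambda>j. h_transform h (d - j)))"
  proof (rule f_to_h_cong)
    fix n assume n: "n \<le> d"
    have "h_to_f d (h_transform h) k = ?f k" if "k \<le> d" for k
      using that by (simp add: h_transform_def h_to_f_f_to_h)
    then have "euler_dual d ?f n = euler_dual d (h_to_f d (h_transform h)) n"
      by (simp add: euler_dual_def)
    then show "euler_dual d ?f n = h_to_f d (\<lambda>j. h_transform h (d - j)) n"
      by (simp add: h_to_f_reverse[OF n])
  qed
  finally show ?thesis using assms by (simp add: f_to_h_h_to_f)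
qed

text \<open>Entry \<open>0\<close> of an h-vector is the number of empty faces, which a triangulation keeps; by symmetry
  the last entry is kept as well.\<close>

lemma h_transform_first: "h_transform h 0 = h 0"
  by (simp add: h_transform_def f_to_h_0 f_transform_0 h_to_f_0)

lemma h_transform_last: "h_transform h d = h d"
  using h_transform_reverse[of 0 h] h_transform_first[of "\<lambda>j. h (d - j)"] by simp

lemma h_transform_surj: "\<exists>h. \<forall>i\<le>d. h_transform h i = g i"
proof -
  obtain f where f: "\<forall>n\<le>d. f_transform d F f n = h_to_f d g n"
    using f_transform_surj open_face_coeff_diag by blast
  have "f_transform d F (h_to_f d (f_to_h d f)) = f_transform d F f"
    by (rule f_transform_cong) (rule h_to_f_f_to_h)
  then have "h_transform (f_to_h d f) = f_to_h d (h_to_f d g)"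
    unfolding h_transform_def using f by (simp cong: f_to_h_cong)
  then show ?thesis by (intro exI[of _ "f_to_h d f"]) (simp add: f_to_h_h_to_f)
qed

text \<open>Otherwise row \<open>i\<close> is a multiple of the last unit vector, which is row \<open>d\<close>; this contradicts
  surjectivity.\<close>

lemma H_matrix_row_nonzero:
  assumes "i < d"
  shows "\<exists>j<d. H_matrix d F $$ (i, j) \<noteq> 0"
proof (rule ccontr)
  assume "\<not> ?thesis"
  then have zero: "H_matrix d F $$ (i, j) = 0" if "j < d" for j using that by blast
  obtain h where h: "\<And>k. k \<le> d \<Longrightarrow> h_transform h k = (if k = i then 1 else 0)"
    using h_transform_surj[of "\<lambda>k. if k = i then 1 else 0"] by blast
  have "h d = 0" using h[of d] h_transform_last[of h] assms by simp
  then have "h_transform h i = 0"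
    using assms zero by (subst h_transform_matrix) (auto intro!: sum.neutral simp: le_less)
  then show False using h[of i] assms by simp
qed

lemma h_transform_pos:
  assumes "TP2 (H_matrix d F)" "i < d" "\<And>j. j \<le> d \<Longrightarrow> 0 \<le> h j" "\<And>j. j < d \<Longrightarrow> 0 < h j"
  shows "0 < h_transform h i"
proof -
  have nn: "0 \<le> H_matrix d F $$ (i, j)" if "j \<le> d" for j
    using assms(1,2) that unfolding TP2_def by (simp add: H_matrix_def)
  obtain j where j: "j < d" "H_matrix d F $$ (i, j) \<noteq> 0"
    using H_matrix_row_nonzero[OF assms(2)] by blast
  then have "0 < H_matrix d F $$ (i, j) * h j"
    using nn[of j] assms(4)[of j] by (simp add: less_le)
  then have "0 < (\<Sum>j\<le>d. H_matrix d F $$ (i, j) * h j)"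
    using j nn assms(3) by (intro sum_pos2[of _ j]) auto
  then show ?thesis using assms(2) by (simp add: h_transform_matrix)
qed

text \<open>A vector \<open>u\<close> whose quotient by \<open>v\<close> decreases is mapped to one whose quotient by the image of \<open>v\<close>
  decreases. The cross-multiplied form also makes sense when entries vanish.\<close>

lemma h_transform_cross:
  assumes TP: "TP2 (H_matrix d F)" and ii: "i < i'" "i' \<le> d"
    and uv: "\<And>j k. j < k \<Longrightarrow> k \<le> d \<Longrightarrow> u k * v j \<le> u j * v k"
  shows "h_transform u i' * h_transform v i \<le> h_transform u i * h_transform v i'"
proof -
  have "H_matrix d F $$ (i, k) * H_matrix d F $$ (i', j) \<le> H_matrix d F $$ (i, j) * H_matrix d F $$ (i', k)"
    if "j < k" "k \<le> d" for j k
    using TP ii that unfolding TP2_def by (simp add: H_matrix_def)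
  from TP2_pair_preserved[OF this uv] show ?thesis
    using ii by (simp add: h_transform_matrix)
qed

end

lemma face_uniform_triangulationE:
  assumes "face_uniform_triangulation TYPE('e::euclidean_space) F \<Delta> \<Delta>'" "complex_dim \<Delta> = int d - 1"
  obtains \<phi> :: "'a \<Rightarrow> 'e::euclidean_space" and \<psi> :: "'b \<Rightarrow> 'e::euclidean_space" where "uniform_subdivision \<Delta> \<phi> \<Delta>' \<psi> F d"
  using assms unfolding face_uniform_triangulation_def
  apply (elim conjE exE)
  subgoal for \<phi> \<psi>
    apply (rule that[of \<phi> \<psi>])
    apply unfold_locales
    apply auto
    done
  done

section \<open>Monotone quotients\<close>

lemma chain_mono_real:
  fixes r :: "nat \<Rightarrow> real"
  assumes "\<And>i. a \<le> i \<Longrightarrow> i < b \<Longrightarrow> r i \<le> r (i + 1)" "a \<le> j" "j \<le> k" "k \<le> b"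
  shows "r j \<le> r k"
  using assms(3,4)
proof (induction k rule: dec_induct)
  case (step n)
  then show ?case using assms(1)[of n] assms(2) by fastforce
qed simp

theorem proposition2p2:
  fixes d :: nat and F :: "nat \<Rightarrow> nat \<Rightarrow> nat"
    and \<Delta> :: "'a set set" and \<Delta>\<^sub>F :: "'b set set"
  assumes "d \<ge> 1"
    and "TP2 (H_matrix d F)"
    and "complex_dim \<Delta> = int d - 1"
    and "face_uniform_triangulation TYPE('e::euclidean_space) F \<Delta> \<Delta>\<^sub>F"
  shows
    "((\<forall>i\<le>d. h_vector \<Delta> i > 0) \<and>
      (\<forall>i<d. h_vector \<Delta> i / h_vector \<Delta> (d - i)
             \<le> h_vector \<Delta> (i + 1) / h_vector \<Delta> (d - (i + 1)))
      \<longrightarrow>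
      (\<forall>i\<le>d. h_vector \<Delta>\<^sub>F i > 0) \<and>
      (\<forall>i<d. h_vector \<Delta>\<^sub>F i / h_vector \<Delta>\<^sub>F (d - i)
             \<le> h_vector \<Delta>\<^sub>F (i + 1) / h_vector \<Delta>\<^sub>F (d - (i + 1))))
     \<and>
     ((\<forall>i. 1 \<le> i \<and> i \<le> d - 1 \<longrightarrow> h_vector \<Delta> i > 0) \<and> h_vector \<Delta> d = 0 \<and>
      (\<forall>i. 1 \<le> i \<and> i + 1 \<le> d - 1 \<longrightarrow>
             h_vector \<Delta> i / h_vector \<Delta> (d - i)
             \<ge> h_vector \<Delta> (i + 1) / h_vector \<Delta> (d - (i + 1)))
      \<longrightarrow>
      (\<forall>i. 1 \<le> i \<and> i \<le> d - 1 \<longrightarrow> h_vector \<Delta>\<^sub>F i > 0) \<and> h_vector \<Delta>\<^sub>F d = 0 \<and>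
      (\<forall>i. 1 \<le> i \<and> i + 1 \<le> d - 1 \<longrightarrow>
             h_vector \<Delta>\<^sub>F i / h_vector \<Delta>\<^sub>F (d - i)
             \<ge> h_vector \<Delta>\<^sub>F (i + 1) / h_vector \<Delta>\<^sub>F (d - (i + 1))))"
proof -
  obtain \<phi> :: "'a \<Rightarrow> 'e" and \<psi> :: "'b \<Rightarrow> 'e" where "uniform_subdivision \<Delta> \<phi> \<Delta>\<^sub>F \<psi> F d"
    using face_uniform_triangulationE[OF assms(4,3)] by blast
  then interpret uniform_subdivision \<Delta> \<phi> \<Delta>\<^sub>F \<psi> F d .
  note TP = assms(2)
  define h where "h = h_vector \<Delta>"
  define r where "r = (\<lambda>i. h (d - i))"
  have h': "h_vector \<Delta>\<^sub>F = h_transform h" by (simp add: h_vector_subdivision h_def)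
  have r': "h_transform h (d - i) = h_transform r i" if "i \<le> d" for i
    using h_transform_reverse[OF that, of h] by (simp add: r_def)
  have h0: "h 0 = 1"
  proof -
    have "{\<sigma> \<in> \<Delta>. card \<sigma> = 0} = {{}}"
      using coarse.finite_face coarse.empty_face by auto
    then show ?thesis
      unfolding h_def h_vector_def f_to_h_0 f_vector_card by simp
  qed
  \<comment> \<open>The quotient \<open>r / h\<close> decreases, and so does its image.\<close>
  have part1: "(\<forall>i\<le>d. h_transform h i > 0) \<and>
      (\<forall>i<d. h_transform h i / h_transform h (d - i)
             \<le> h_transform h (i + 1) / h_transform h (d - (i + 1)))"
    if pos: "\<forall>i\<le>d. h i > 0" and mono: "\<forall>i<d. h i / h (d - i) \<le> h (i + 1) / h (d - (i + 1))"
  proof -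
    have pos': "h_transform h i > 0" if "i \<le> d" for i
      using that h_transform_pos[OF TP, of i h] pos h_transform_last[of h]
      by (cases "i = d") (auto simp: less_imp_le)
    have cross: "r k * h j \<le> r j * h k" if "j < k" "k \<le> d" for j k
    proof -
      have "h j / r j \<le> h k / r k"
        unfolding r_def
        by (rule chain_mono_real[of 0 d "\<lambda>i. h i / h (d - i)"]) (use mono that in auto)
      moreover have "r j > 0" "r k > 0" using pos by (simp_all add: r_def)
      ultimately show ?thesis by (simp add: field_simps)
    qed
    have "h_transform h i / h_transform h (d - i) \<le> h_transform h (i + 1) / h_transform h (d - (i + 1))"
      if i: "i < d" for i
    proof -
      have "h_transform r (i + 1) * h_transform h i \<le> h_transform r i * h_transform h (i + 1)"
        using i cross by (intro h_transform_cross[OF TP]) auto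
      moreover have "h_transform r i > 0" "h_transform r (i + 1) > 0"
        using pos'[of "d - i"] pos'[of "d - (i + 1)"] r'[of i] r'[of "i + 1"] i by simp_all
      ultimately show ?thesis using r'[of i] r'[of "i + 1"] i by (simp add: field_simps)
    qed
    with pos' show ?thesis by blast
  qed
  \<comment> \<open>Here the end entries are \<open>h 0 = 1\<close> and \<open>h d = 0\<close>, so that \<open>h / r\<close> decreases, from infinity to
    \<open>0\<close>, over the whole range \<open>0..d\<close> and not only over \<open>1..d - 1\<close>.\<close>
  have part2: "(\<forall>i. 1 \<le> i \<and> i \<le> d - 1 \<longrightarrow> h_transform h i > 0) \<and> h_transform h d = 0 \<and>
      (\<forall>i. 1 \<le> i \<and> i + 1 \<le> d - 1 \<longrightarrow>
             h_transform h i / h_transform h (d - i)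
             \<ge> h_transform h (i + 1) / h_transform h (d - (i + 1)))"
    if pos: "\<forall>i. 1 \<le> i \<and> i \<le> d - 1 \<longrightarrow> h i > 0" and hd: "h d = 0"
      and mono: "\<forall>i. 1 \<le> i \<and> i + 1 \<le> d - 1 \<longrightarrow> h i / h (d - i) \<ge> h (i + 1) / h (d - (i + 1))"
  proof -
    have hpos: "h j > 0" if "j < d" for j
      using pos h0 that by (cases "j = 0") auto
    have hnn: "h j \<ge> 0" if "j \<le> d" for j
      using hpos[of j] hd that by (cases "j = d") auto
    have pos': "h_transform h i > 0" if "i < d" for i
      using h_transform_pos[OF TP that] hpos hnn by blast
    have cross: "h k * r j \<le> h j * r k" if jk: "j < k" "k \<le> d" for j k
    proof (cases "j = 0 \<or> k = d")
      case True
      then have "h k * r j = 0" using hd by (auto simp: r_def)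
      moreover have "h j * r k \<ge> 0" using hnn jk by (simp add: r_def)
      ultimately show ?thesis by linarith
    next
      case False
      have "- (h j / r j) \<le> - (h k / r k)"
        unfolding r_def
        by (rule chain_mono_real[of 1 "d - 1" "\<lambda>i. - (h i / h (d - i))"]) (use mono jk False in auto)
      moreover have "r j > 0" "r k > 0" using hpos False jk by (simp_all add: r_def)
      ultimately show ?thesis by (simp add: field_simps)
    qed
    have "h_transform h i / h_transform h (d - i) \<ge> h_transform h (i + 1) / h_transform h (d - (i + 1))"
      if i: "1 \<le> i" "i + 1 \<le> d - 1" for i
    proof -
      have "h_transform h (i + 1) * h_transform r i \<le> h_transform h i * h_transform r (i + 1)"
        using i cross by (intro h_transform_cross[OF TP]) auto
      moreover have "h_transform r i > 0" "h_transform r (i + 1) > 0"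
        using pos'[of "d - i"] pos'[of "d - (i + 1)"] r'[of i] r'[of "i + 1"] i by simp_all
      ultimately show ?thesis using r'[of i] r'[of "i + 1"] i by (simp add: field_simps)
    qed
    with pos' hd h_transform_last[of h] show ?thesis by auto
  qed
  show ?thesis unfolding h' h_def[symmetric] using part1 part2 by blast
qed

end
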